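(* Let $\mathbb{F}$ be a field of characteristic $3$. The Matsuo algebra $M_{1/2}(\mathcal{P}_3)$ over $\mathbb{F}$ is isomorphic to a $9$-dimensional non-unital Jordan algebra $J$ with an $8$-dimensional radical $R$. Furthermore, there is a chain of ideals of $J$ $$0<Z<T<R<J\quad\text{with } \dim Z=1,\ \dim T=6,\ \text{and } Z=T^2,\ T=R^2,$$ such that the elements of $Z$ are trivial, the elements of $T$ are absolute zero divisors, and $J/R$ is a unital Jordan algebra isomorphic to $\mathbb{F}$.
   Context: $\mathcal{P}_3$ is the affine plane of order $3$: its points are the $9$ elements of $\mathbb{F}_3^2$ and its lines are the $12$ affine lines. For distinct points $x,y$, $x\wedge y$ denotes the third point of the line through $x$ and $y$. The Matsuo algebra $M_{1/2}(\mathcal{P}_3)$ is the commutative, not necessarily associative $\mathbb{F}$-algebra with basis the points of $\mathcal{P}_3$ and multiplication $xx=x$ and $xy=\frac14(x+y-x\wedge y)$ for distinct points $x,y$. A Jordan algebra over $\mathbb{F}$ is a commutative $\mathbb{F}$-algebra (not necessarily associative or unital) with $(ab)(aa)=a(b(aa))$ for all $a,b$. For an ideal $I$, $I^2$ denotes the span of all products $ab$ with $a,b\in I$; $I$ is solvable if $I^{2^k}=0$ for some $k\ge0$, where $I^1=I$ and $I^{2^k}=(I^{2^{k-1}})^2$. The radical of a finite-dimensional Jordan algebra is its unique largest solvable ideal. For $a\in J$, the $U$-operator is the linear map $U_a(b)=2a(ab)-a^2b$. An element $a$ is an absolute zero divisor if $U_a=0$, and is trivial if $U_a=0$ and $a^2=0$.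 *)

theory Defs
  imports
    "Jordan_Normal_Form.VS_Connect"
    "HOL-Algebra.QuotRing"
    "HOL-Library.Numeral_Type"
begin

section \<open>Non-associative algebras and Jordan algebras\<close>

text \<open>
  Algebras are records of type \<^typ>\<open>('k, 'a) module\<close>.  Neither associativity nor a unit is
  required; the record field \<open>one\<close> carries no meaning here, and an algebra is unital if it has
  some identity element, see \<open>unital\<close> below.
\<close>

locale nonassoc_algebra =
  fixes K and A (structure)
  assumes vs: "vectorspace K A"
    and m_closed: "\<lbrakk>x \<in> carrier A; y \<in> carrier A\<rbrakk> \<Longrightarrow> x \<otimes> y \<in> carrier A"
    and l_distr: "\<lbrakk>x \<in> carrier A; y \<in> carrier A; z \<in> carrier A\<rbrakk> \<Longrightarrow>
      (x \<oplus> y) \<otimes> z = x \<otimes> z \<oplus> y \<otimes> z"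
    and r_distr: "\<lbrakk>x \<in> carrier A; y \<in> carrier A; z \<in> carrier A\<rbrakk> \<Longrightarrow>
      z \<otimes> (x \<oplus> y) = z \<otimes> x \<oplus> z \<otimes> y"
    and smult_l: "\<lbrakk>c \<in> carrier K; x \<in> carrier A; y \<in> carrier A\<rbrakk> \<Longrightarrow>
      (c \<odot> x) \<otimes> y = c \<odot> (x \<otimes> y)"
    and smult_r: "\<lbrakk>c \<in> carrier K; x \<in> carrier A; y \<in> carrier A\<rbrakk> \<Longrightarrow>
      x \<otimes> (c \<odot> y) = c \<odot> (x \<otimes> y)"

locale jordan_algebra = nonassoc_algebra +
  assumes m_comm: "\<lbrakk>a \<in> carrier A; b \<in> carrier A\<rbrakk> \<Longrightarrow> a \<otimes> b = b \<otimes> a"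
    and jordan_identity: "\<lbrakk>a \<in> carrier A; b \<in> carrier A\<rbrakk> \<Longrightarrow>
      (a \<otimes> b) \<otimes> (a \<otimes> a) = a \<otimes> (b \<otimes> (a \<otimes> a))"

definition unital :: "('k, 'a) module \<Rightarrow> bool" where
  "unital A \<longleftrightarrow> (\<exists>e\<in>carrier A. \<forall>x\<in>carrier A. e \<otimes>\<^bsub>A\<^esub> x = x \<and> x \<otimes>\<^bsub>A\<^esub> e = x)"

definition algebra_iso :: "'k ring \<Rightarrow> ('k, 'a) module \<Rightarrow> ('k, 'b) module \<Rightarrow> ('a \<Rightarrow> 'b) set" where
  "algebra_iso K A B =
    {f \<in> LinearCombinations.module_hom K A B. bij_betw f (carrier A) (carrier B) \<and>
      (\<forall>x\<in>carrier A. \<forall>y\<in>carrier A. f (x \<otimes>\<^bsub>A\<^esub> y) = f x \<otimes>\<^bsub>B\<^esub> f y)}"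

definition algebra_isomorphic :: "'k ring \<Rightarrow> ('k, 'a) module \<Rightarrow> ('k, 'b) module \<Rightarrow> bool" where
  "algebra_isomorphic K A B \<longleftrightarrow> algebra_iso K A B \<noteq> {}"

definition algebra_ideal :: "'k ring \<Rightarrow> ('k, 'a) module \<Rightarrow> 'a set \<Rightarrow> bool" where
  "algebra_ideal K A I \<longleftrightarrow> subspace K I A \<and>
    (\<forall>a\<in>I. \<forall>x\<in>carrier A. a \<otimes>\<^bsub>A\<^esub> x \<in> I \<and> x \<otimes>\<^bsub>A\<^esub> a \<in> I)"

definition subspace_dim :: "'k ring \<Rightarrow> ('k, 'a) module \<Rightarrow> 'a set \<Rightarrow> nat" where
  "subspace_dim K A W = vectorspace.dim K (A\<lparr>carrier := W\<rparr>)"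

definition ideal_square :: "'k ring \<Rightarrow> ('k, 'a) module \<Rightarrow> 'a set \<Rightarrow> 'a set" where
  "ideal_square K A I = LinearCombinations.module.span K A {a \<otimes>\<^bsub>A\<^esub> b | a b. a \<in> I \<and> b \<in> I}"

text \<open>The \<open>k\<close>-fold iterate of \<^const>\<open>ideal_square\<close> is $I \mapsto I^{2^k}$.\<close>

definition solvable_ideal :: "'k ring \<Rightarrow> ('k, 'a) module \<Rightarrow> 'a set \<Rightarrow> bool" where
  "solvable_ideal K A I \<longleftrightarrow> algebra_ideal K A I \<and>
    (\<exists>k. (ideal_square K A ^^ k) I = {\<zero>\<^bsub>A\<^esub>})"

definition is_radical :: "'k ring \<Rightarrow> ('k, 'a) module \<Rightarrow> 'a set \<Rightarrow> bool" where
  "is_radical K A R \<longleftrightarrow> solvable_ideal K A R \<and> (\<forall>I. solvable_ideal K A I \<longrightarrow> I \<subseteq> R)"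

definition U_operator :: "'k ring \<Rightarrow> ('k, 'a) module \<Rightarrow> 'a \<Rightarrow> 'a \<Rightarrow> 'a" where
  "U_operator K A a b =
    (\<one>\<^bsub>K\<^esub> \<oplus>\<^bsub>K\<^esub> \<one>\<^bsub>K\<^esub>) \<odot>\<^bsub>A\<^esub> (a \<otimes>\<^bsub>A\<^esub> (a \<otimes>\<^bsub>A\<^esub> b)) \<ominus>\<^bsub>A\<^esub> (a \<otimes>\<^bsub>A\<^esub> a) \<otimes>\<^bsub>A\<^esub> b"

definition absolute_zero_divisor :: "'k ring \<Rightarrow> ('k, 'a) module \<Rightarrow> 'a \<Rightarrow> bool" where
  "absolute_zero_divisor K A a \<longleftrightarrow>
    a \<in> carrier A \<and> (\<forall>b\<in>carrier A. U_operator K A a b = \<zero>\<^bsub>A\<^esub>)"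

definition trivial_element :: "'k ring \<Rightarrow> ('k, 'a) module \<Rightarrow> 'a \<Rightarrow> bool" where
  "trivial_element K A a \<longleftrightarrow> absolute_zero_divisor K A a \<and> a \<otimes>\<^bsub>A\<^esub> a = \<zero>\<^bsub>A\<^esub>"

text \<open>
  The coset construction \<^const>\<open>FactRing\<close> only involves the operations of its argument, so it
  also applies to non-associative algebras; it is extended by the scalar multiplication
  $c (I + x) = I + c x$.
\<close>

definition quotient_algebra :: "('k, 'a) module \<Rightarrow> 'a set \<Rightarrow> ('k, 'a set) module" where
  "quotient_algebra A I =
    ring.extend (A Quot I) (module.fields (\<lambda>c X. \<Union>x\<in>X. I +>\<^bsub>A\<^esub> (c \<odot>\<^bsub>A\<^esub> x)))"

definition field_algebra :: "'k ring \<Rightarrow> ('k, 'k) module" where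
  "field_algebra K = ring.extend K (module.fields (\<lambda>c x. c \<otimes>\<^bsub>K\<^esub> x))"


section \<open>The affine plane of order 3 and its Matsuo algebra\<close>

text \<open>The numeral type \<^typ>\<open>3\<close> is the ring of integers modulo 3.\<close>

type_synonym point = "3 \<times> 3"

definition affine_lines :: "point set set" where
  "affine_lines = {range (\<lambda>t. (a + t * u, b + t * v)) | a b u v. (u, v) \<noteq> (0, 0)}"

definition third_point :: "point \<Rightarrow> point \<Rightarrow> point" where
  "third_point x y = (THE z. z \<noteq> x \<and> z \<noteq> y \<and> (\<exists>l\<in>affine_lines. x \<in> l \<and> y \<in> l \<and> z \<in> l))"

text \<open>
  An element of the Matsuo algebra is given by its coordinates with respect to the basis of
  points; its product is the bilinear extension of \<open>matsuo_basis_mult\<close>.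
\<close>

definition point_vector :: "point \<Rightarrow> point \<Rightarrow> 'k::field" where
  "point_vector x = (\<lambda>z. if z = x then 1 else 0)"

definition matsuo_basis_mult :: "point \<Rightarrow> point \<Rightarrow> point \<Rightarrow> 'k::field" where
  "matsuo_basis_mult x y =
    (if x = y then point_vector x
     else (\<lambda>z. 1 / 4 * (point_vector x z + point_vector y z - point_vector (third_point x y) z)))"

definition matsuo_algebra :: "('k::field, point \<Rightarrow> 'k) module" where
  "matsuo_algebra =
    \<lparr>carrier = UNIV,
     mult = (\<lambda>f g z. \<Sum>x\<in>UNIV. \<Sum>y\<in>UNIV. f x * g y * matsuo_basis_mult x y z),
     one = undefined,
     zero = (\<lambda>z. 0),
     add = (\<lambda>f g z. f z + g z),
     smult = (\<lambda>c f z. c * f z)\<rparr>"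

end

theory Submission
  imports Defs "HOL-Library.Poly_Mapping" "HOL-Library.Product_Plus"
begin

text \<open>
  In characteristic 3 the third point of the line through \<open>x\<close> and \<open>y\<close> is \<open>-(x + y)\<close> and \<open>1/4 = 1\<close>,
  so \<open>x y = x + y - (-x - y)\<close> holds for all points, equal or not.  In terms of the group algebra
  $A = \mathbb{F}[\mathbb{F}_3^2] \cong \mathbb{F}[s,t]/(s^3,t^3)$ with augmentation $\varepsilon$ and inversion
  $\sigma$, the Matsuo product is therefore
  $f \cdot g = \varepsilon(g) f + \varepsilon(f) g - \sigma(f g)$.
  The Jordan identity reduces to $a^3 = \varepsilon(a)^3 = \sigma(a)^3$.
  On the augmentation ideal $R = (s,t)$ the product is $-\sigma(fg)$, so $T = R^2 = (s,t)^2$ and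
  $Z = T^2 = (s,t)^4$, the line of constant functions, and the chain ends there because constants
  annihilate the algebra.  As $\varepsilon$ is also multiplicative for the Matsuo product,
  $J/R \cong \mathbb{F}$, and no solvable ideal can leave $R = \ker \varepsilon$.
\<close>

section \<open>Spaces of functions\<close>

lemma finsum_pointwise:
  fixes V :: "('k::field, 'a \<Rightarrow> 'k) module"
  assumes "abelian_monoid V"
    and add: "add V = (\<lambda>f g z. f z + g z)" and zero: "zero V = (\<lambda>z. 0)"
    and "finite A" "g \<in> A \<rightarrow> carrier V"
  shows "finsum V g A = (\<lambda>z. \<Sum>a\<in>A. g a z)"
  using assms(4,5)
proof (induction A rule: finite_induct)
  case empty
  interpret abelian_monoid V by fact
  show ?case by (simp add: zero)
next
  case (insert x F)
  interpret abelian_monoid V by fact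
  from insert show ?case by (simp add: finsum_insert Pi_iff add)
qed

text \<open>The vectors \<open>w p\<close> are dual to the evaluations at the points of
  \<open>I\<close>. Evaluation gives independence; they span because a vector minus its
  interpolation vanishes on \<open>I\<close>, hence everywhere. The carrier stays open so that
  proper subspaces are covered.\<close>

lemma dim_pointwise:
  fixes V :: "('k::field, 'a \<Rightarrow> 'k) module" and w :: "'a \<Rightarrow> 'a \<Rightarrow> 'k"
  assumes V: "vectorspace class_ring V"
    and add: "add V = (\<lambda>f g z. f z + g z)" and zero: "zero V = (\<lambda>z. 0)"
    and smult: "smult V = (\<lambda>c f z. c * f z)"
    and I: "finite I"
    and w: "\<And>p. p \<in> I \<Longrightarrow> w p \<in> carrier V"
    and dual: "\<And>p q. p \<in> I \<Longrightarrow> q \<in> I \<Longrightarrow> w p q = (if p = q then 1 else 0)"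
    and sep: "\<And>f. f \<in> carrier V \<Longrightarrow> (\<And>p. p \<in> I \<Longrightarrow> f p = 0) \<Longrightarrow> f = (\<lambda>z. 0)"
  shows "vectorspace.fin_dim class_ring V" "vectorspace.dim class_ring V = card I"
proof -
  interpret V: vectorspace class_ring V by fact
  have inj: "inj_on w I" by (rule inj_onI) (metis dual zero_neq_one)
  have sub: "w ` I \<subseteq> carrier V" using w by auto
  have lc: "V.lincomb a (w ` I) = (\<lambda>z. \<Sum>p\<in>I. a (w p) * w p z)" for a
  proof -
    have "V.lincomb a (w ` I) = (\<lambda>z. \<Sum>v\<in>w ` I. (a v \<odot>\<^bsub>V\<^esub> v) z)"
      unfolding V.lincomb_def
    proof (rule finsum_pointwise)
      show "(\<lambda>v. a v \<odot>\<^bsub>V\<^esub> v) \<in> w ` I \<rightarrow> carrier V"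
        using V.smult_closed sub by auto
    qed (use V.abelian_monoid_axioms add zero I in auto)
    then show ?thesis using inj by (simp add: smult sum.reindex)
  qed
  have lc_at: "V.lincomb a (w ` I) q = a (w q)" if "q \<in> I" for a q
  proof -
    have "V.lincomb a (w ` I) q = (\<Sum>p\<in>I. if p = q then a (w p) else 0)"
      unfolding lc by (intro sum.cong) (auto simp: dual that)
    then show ?thesis using that I by simp
  qed
  have ind: "V.lin_indpt (w ` I)"
  proof (rule V.finite_lin_indpt2)
    fix a assume "V.lincomb a (w ` I) = \<zero>\<^bsub>V\<^esub>"
    then have "a (w q) = 0" if "q \<in> I" for q using lc_at[OF that, of a] by (simp add: zero)
    then show "\<forall>v\<in>w ` I. a v = \<zero>\<^bsub>class_ring\<^esub>" by simp
  qed (use I sub in auto)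
  have gen: "V.gen_set (w ` I)"
  proof
    show "V.span (w ` I) \<subseteq> carrier V" by (rule V.span_is_subset2[OF sub])
    show "carrier V \<subseteq> V.span (w ` I)"
    proof
      fix f assume f: "f \<in> carrier V"
      \<comment> \<open>This interpolates \<open>f\<close> on \<open>I\<close>. Coefficients are
        indexed by vectors, hence the inverse of \<open>w\<close>.\<close>
      define g where "g = V.lincomb (\<lambda>v. f (the_inv_into I w v)) (w ` I)"
      have g: "g \<in> carrier V" unfolding g_def by (rule V.lincomb_closed) (use sub in auto)
      define h where "h = f \<oplus>\<^bsub>V\<^esub> (- 1) \<odot>\<^bsub>V\<^esub> g"
      have "h \<in> carrier V" unfolding h_def
        by (intro V.add.m_closed V.smult_closed f g) simp
      moreover have "h p = 0" if "p \<in> I" for p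
        using lc_at[OF that] the_inv_into_f_f[OF inj that] by (simp add: h_def g_def add smult)
      ultimately have "h = (\<lambda>z. 0)" by (rule sep)
      then have "f z = g z" for z by (simp add: h_def add smult fun_eq_iff)
      then have "f = g" ..
      then show "f \<in> V.span (w ` I)" unfolding V.span_def g_def using I by auto
    qed
  qed
  from ind gen sub have "V.basis (w ` I)" by (simp add: V.basis_def)
  then show "V.dim = card I" using V.dim_basis[of "w ` I"] I card_image[OF inj] by simp
  show "V.fin_dim" unfolding V.fin_dim_def using I sub gen by blast
qed

lemma matsuo_simps [simp]:
  "carrier matsuo_algebra = UNIV"
  "add matsuo_algebra = (\<lambda>f g z. f z + g z)"
  "zero matsuo_algebra = (\<lambda>z. 0)"
  "smult matsuo_algebra = (\<lambda>c f z. c * f z)"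
  by (simp_all add: matsuo_algebra_def)

lemma vectorspace_matsuo: "vectorspace class_ring (matsuo_algebra :: ('k::field, point \<Rightarrow> 'k) module)"
proof -
  let ?M = "matsuo_algebra :: ('k::field, point \<Rightarrow> 'k) module"
  have "abelian_group ?M"
  proof (rule abelian_groupI)
    fix f :: "point \<Rightarrow> 'k"
    show "\<exists>g\<in>carrier ?M. g \<oplus>\<^bsub>?M\<^esub> f = \<zero>\<^bsub>?M\<^esub>" by (auto intro: exI[of _ "\<lambda>z. - f z"])
  qed (auto simp: algebra_simps)
  then have "module class_ring ?M"
    by (intro Module.moduleI class_cring.is_cring) (auto simp: algebra_simps)
  then show ?thesis by (intro vectorspace.intro class_field)
qed

lemma module_matsuo: "module class_ring (matsuo_algebra :: ('k::field, point \<Rightarrow> 'k) module)"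
  by (rule vectorspace.axioms(1)[OF vectorspace_matsuo])

section \<open>The affine plane\<close>

lemma in_3_cases: "x = 0 \<or> x = 1 \<or> x = (2::3)"
proof (cases x)
  case (of_int z)
  then have "z = 0 \<or> z = 1 \<or> z = 2" by auto
  with of_int show ?thesis by auto
qed

lemma UNIV_3: "(UNIV :: 3 set) = {0, 1, 2}" using in_3_cases by auto

lemma sum_3: "(\<Sum>i\<in>UNIV. f i) = f 0 + f 1 + f (2::3)" for f :: "3 \<Rightarrow> 'b::comm_monoid_add"
proof -
  have "(0::3) \<notin> {1, 2}" "(1::3) \<notin> {2}" by simp_all
  then show ?thesis unfolding UNIV_3
    by (simp only: sum.insert finite.intros sum.empty add.assoc add_0_right not_False_eq_True empty_iff)
qed

lemma sum_point: "(\<Sum>p\<in>UNIV. f p) = (\<Sum>i\<in>UNIV. \<Sum>j\<in>UNIV. f (i, j))" for f :: "point \<Rightarrow> 'b::comm_monoid_add"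
  by (simp add: sum.cartesian_product)

text \<open>Three distinct residues exhaust the integers modulo 3, and 0 + 1 + 2 = 0 there.\<close>

lemma third_in_3:
  fixes r s t :: 3
  assumes "r \<noteq> s" "r \<noteq> t" "s \<noteq> t"
  shows "r = - s - t"
  using in_3_cases[of r] in_3_cases[of s] in_3_cases[of t] assms by auto

lemma three_point: "p + p + p = (0::point)"
  using in_3_cases[of "fst p"] in_3_cases[of "snd p"] by (auto simp: plus_prod_def zero_prod_def)

lemma minus_double: "- x - x = (x::point)"
  by (metis add.commute diff_conv_add_uminus eq_neg_iff_add_eq_0 minus_add_distrib three_point)

lemma minus_sum_eq_iff: "- (x + y) = x \<longleftrightarrow> x = y" for x y :: point
proof -
  have "- (x + y) = - x - y" by simp
  also have "\<dots> = x \<longleftrightarrow> - x - y = - x - x" by (simp only: minus_double)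
  finally show ?thesis by auto
qed

text \<open>In direction y - x the points x, y and -(x + y) have parameters 0, 1 and 2. Conversely,
  three distinct parameters on a line sum to 0, and so do three copies of the base point, so the
  three points sum to 0.\<close>

lemma third_point_eq:
  assumes "x \<noteq> y"
  shows "third_point x y = - (x + y)"
  unfolding third_point_def
proof (rule the_equality)
  define u where "u = y - x"
  have "u \<noteq> 0" using assms by (simp add: u_def)
  let ?l = "range (\<lambda>t. (fst x + t * fst u, snd x + t * snd u))"
  have "?l \<in> affine_lines" using \<open>u \<noteq> 0\<close>
    unfolding affine_lines_def by (force simp: zero_prod_def prod_eq_iff)
  moreover have "x \<in> ?l" by (rule range_eqI[of _ _ 0]) simp
  moreover have "y \<in> ?l" by (rule range_eqI[of _ _ 1]) (simp add: u_def)
  moreover have "- (x + y) \<in> ?l"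
    using three_point[of x] three_point[of y]
    by (intro range_eqI[of _ _ 2]) (simp add: u_def prod_eq_iff algebra_simps)
  ultimately have "\<exists>l\<in>affine_lines. x \<in> l \<and> y \<in> l \<and> - (x + y) \<in> l"
    by (intro bexI[of _ ?l] conjI)
  moreover have "- (x + y) \<noteq> x" using assms by (simp only: minus_sum_eq_iff not_False_eq_True)
  moreover have "- (x + y) \<noteq> y"
    unfolding add.commute[of x y] using assms[symmetric] by (simp only: minus_sum_eq_iff not_False_eq_True)
  ultimately show "- (x + y) \<noteq> x \<and> - (x + y) \<noteq> y \<and> (\<exists>l\<in>affine_lines. x \<in> l \<and> y \<in> l \<and> - (x + y) \<in> l)"
    by (intro conjI)
next
  fix z assume "z \<noteq> x \<and> z \<noteq> y \<and> (\<exists>l\<in>affine_lines. x \<in> l \<and> y \<in> l \<and> z \<in> l)"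
  then obtain a b u v s t r where x: "x = (a + s * u, b + s * v)" and y: "y = (a + t * u, b + t * v)"
    and z: "z = (a + r * u, b + r * v)" and ne: "z \<noteq> x" "z \<noteq> y"
    unfolding affine_lines_def by blast
  have "r = - s - t" using ne assms unfolding x y z by (intro third_in_3) blast+
  moreover have "a + a + a = 0" "b + b + b = 0" using three_point[of "(a, b)"]
    by (auto simp: plus_prod_def zero_prod_def)
  ultimately show "z = - (x + y)"
    unfolding x y z prod_eq_iff eq_neg_iff_add_eq_0 by (simp add: left_diff_distrib add_ac)
qed

lemma sum_point_vector: "(\<Sum>x\<in>UNIV. f x * point_vector x z) = (f z :: 'k::field)"
  by (simp add: point_vector_def if_distrib[of "\<lambda>a. _ * a"] cong: if_cong)

hide_const (open) Poly_Mapping.range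

section \<open>The group algebra of the plane\<close>

lemma sum_reflect: "(\<Sum>x\<in>UNIV. f (c - x)) = (\<Sum>x\<in>UNIV. f x)"
  for c :: point and f :: "point \<Rightarrow> 'b::comm_monoid_add"
  by (rule sum.reindex_bij_witness[of _ "\<lambda>x. c - x" "\<lambda>x. c - x"]) auto

lemma sum_neg: "(\<Sum>x\<in>UNIV. f (- x)) = (\<Sum>x\<in>UNIV. f x)"
  for f :: "point \<Rightarrow> 'b::comm_monoid_add"
  by (rule sum.reindex_bij_witness[of _ uminus uminus]) auto

text \<open>The product of \<open>poly_mapping\<close> is convolution over the additive group of
  points, so this type is the group algebra, with its commutative ring structure available. The
  plane is finite, so every function has finite support.\<close>

definition grp :: "(point \<Rightarrow> 'k::field) \<Rightarrow> (point \<Rightarrow>\<^sub>0 'k)" where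
  "grp f = Abs_poly_mapping f"

lemma lookup_grp [simp]: "poly_mapping.lookup (grp f) = f"
  by (simp add: grp_def Abs_poly_mapping_inverse)

lemma grp_inject: "grp f = grp g \<longleftrightarrow> f = g"
  by (metis lookup_grp)

lemma lookup_mult_finite:
  "poly_mapping.lookup (a * b) z = (\<Sum>x\<in>UNIV. poly_mapping.lookup a x * poly_mapping.lookup b (z - x))"
  for a b :: "point \<Rightarrow>\<^sub>0 'k::field"
proof -
  have "poly_mapping.lookup (a * b) z =
    (\<Sum>x\<in>UNIV. poly_mapping.lookup a x * (\<Sum>y\<in>UNIV. poly_mapping.lookup b y when z = x + y))"
    by (simp add: lookup_mult Sum_any.expand_superset[of UNIV])
  moreover have "(\<Sum>y\<in>UNIV. poly_mapping.lookup b y when z = x + y) = poly_mapping.lookup b (z - x)" for x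
  proof -
    have "(z = x + y) = (y = z - x)" for y by auto
    then show ?thesis by (simp add: when_def)
  qed
  ultimately show ?thesis by simp
qed

lemma lookup_single_0_mult: "poly_mapping.lookup (Poly_Mapping.single 0 c * a) z = c * poly_mapping.lookup a z"
  for a :: "point \<Rightarrow>\<^sub>0 'k::field"
  by (simp add: lookup_mult_finite lookup_single when_def if_distrib[of "\<lambda>u. u * _"] cong: if_cong)

text \<open>
  The Jordan identity for a product \<open>f \<cdot> g = \<beta> f + \<alpha> g - f' g'\<close>, where \<open>\<alpha>\<close>, \<open>\<beta>\<close> are the
  augmentations of \<open>f\<close>, \<open>g\<close> and the prime is an involution of the ring.
\<close>

lemma twisted_jordan:
  fixes a b a' b' \<alpha> \<beta> :: "'a::comm_ring_1"
  assumes "a ^ 3 = a' ^ 3"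
  shows "(\<alpha> * \<alpha>) * (\<beta> * a + \<alpha> * b - a' * b') + (\<alpha> * \<beta>) * (\<alpha> * a + \<alpha> * a - a' * a')
      - (\<beta> * a' + \<alpha> * b' - a * b) * (\<alpha> * a' + \<alpha> * a' - a * a)
    = (\<beta> * (\<alpha> * \<alpha>)) * a
      + \<alpha> * ((\<alpha> * \<alpha>) * b + \<beta> * (\<alpha> * a + \<alpha> * a - a' * a') - b' * (\<alpha> * a' + \<alpha> * a' - a * a))
      - a' * ((\<alpha> * \<alpha>) * b' + \<beta> * (\<alpha> * a' + \<alpha> * a' - a * a) - b * (\<alpha> * a + \<alpha> * a - a' * a'))"
    (is "?l = ?r")
proof -
  \<comment> \<open>After expansion everything cancels except \<open>b\<close> times the difference
    of the two cubes.\<close>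
  have "?l - ?r = b * (a' * a' * a') - b * (a * a * a)"
    by (simp add: algebra_simps)
  then show ?thesis using assms by (simp add: power3_eq_cube)
qed

section \<open>Powers of the augmentation ideal\<close>

text \<open>This is the map of group algebras induced by the first projection of the plane onto the
  cyclic group of order 3.\<close>

definition row_sum :: "(point \<Rightarrow> 'k::field) \<Rightarrow> 3 \<Rightarrow> 'k" where
  "row_sum f i = (\<Sum>j\<in>UNIV. f (i, j))"

definition aug_ideal :: "(point \<Rightarrow> 'k::field) set" where
  "aug_ideal = {f. sum f UNIV = 0}"

text \<open>
  The square of the augmentation ideal consists of the \<open>f\<close> annihilated by \<open>1\<close> and the two coordinate
  functions; in characteristic 3 this says that all row sums agree and all column sums agree.
\<close>

definition aug_ideal_sq :: "(point \<Rightarrow> 'k::field) set" where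
  "aug_ideal_sq = {f. (\<forall>i. row_sum f i = row_sum f 0) \<and>
    (\<forall>i. row_sum (f \<circ> prod.swap) i = row_sum (f \<circ> prod.swap) 0)}"

definition const_ideal :: "(point \<Rightarrow> 'k::field) set" where
  "const_ideal = {f. \<forall>z. f z = f 0}"

lemma sum_row_sum: "sum f UNIV = sum (row_sum f) UNIV"
  by (simp add: row_sum_def sum_point)

lemma sum_swap_point: "(\<Sum>p\<in>UNIV. f (prod.swap p)) = (\<Sum>p\<in>UNIV. f p)" for f :: "point \<Rightarrow> 'b::comm_monoid_add"
  by (rule sum.reindex_bij_witness[of _ prod.swap prod.swap]) auto

text \<open>Swapping coordinates exchanges rows and columns, so statements about columns below are
  obtained from their row versions.\<close>

lemma swap_in_aug_ideal_sq: "f \<circ> prod.swap \<in> aug_ideal_sq \<longleftrightarrow> f \<in> aug_ideal_sq"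
  by (auto simp: aug_ideal_sq_def comp_def)

lemma arith_3: "- 1 = (2::3)" "- 2 = (1::3)" "3 = (0::3)" "4 = (1::3)" by simp_all

lemma sum_reflect_3: "(\<Sum>x\<in>UNIV. f (c - x)) = (\<Sum>x\<in>UNIV. f x)"
  for c :: 3 and f :: "3 \<Rightarrow> 'b::comm_monoid_add"
  by (rule sum.reindex_bij_witness[of _ "\<lambda>x. c - x" "\<lambda>x. c - x"]) auto

lemma aug_ideal_sq_row_sums:
  assumes "f \<in> aug_ideal_sq"
  shows "row_sum f i = row_sum f 0" "row_sum (f \<circ> prod.swap) i = row_sum (f \<circ> prod.swap) 0"
  using assms unfolding aug_ideal_sq_def by blast+

text \<open>The two unit shifts generate the plane.\<close>

lemma shift_invariant_const:
  assumes "\<And>u. P (u + (1, 0)) = P u" "\<And>u. P (u + (0, 1)) = P (u :: point)"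
  shows "P u = P 0"
proof -
  have 1: "P (1, j) = P (0, j)" "P (2, j) = P (0, j)" for j
    using assms(1)[of "(0, j)"] assms(1)[of "(1, j)"] by simp_all
  have 2: "P (i, 1) = P (i, 0)" "P (i, 2) = P (i, 0)" for i
    using assms(2)[of "(i, 0)"] assms(2)[of "(i, 1)"] by simp_all
  obtain i j where "u = (i, j)" by fastforce
  then show ?thesis
    using in_3_cases[of i] in_3_cases[of j] 1 2 by (auto simp: zero_prod_def)
qed

lemma submodule_matsuoI:
  fixes N :: "(point \<Rightarrow> 'k::field) set"
  assumes "(\<lambda>z. 0) \<in> N" "\<And>f g. f \<in> N \<Longrightarrow> g \<in> N \<Longrightarrow> (\<lambda>z. f z + g z) \<in> N"
    "\<And>c f. f \<in> N \<Longrightarrow> (\<lambda>z. c * f z) \<in> N"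
  shows "LinearCombinations.submodule class_ring N matsuo_algebra"
  using assms module_matsuo
  by (intro LinearCombinations.submodule.intro) auto

lemma submodule_aug_ideal:
  "LinearCombinations.submodule class_ring (aug_ideal :: (point \<Rightarrow> 'k::field) set) matsuo_algebra"
  by (rule submodule_matsuoI) (auto simp: aug_ideal_def sum.distrib simp flip: sum_distrib_left)

lemma submodule_aug_ideal_sq:
  "LinearCombinations.submodule class_ring (aug_ideal_sq :: (point \<Rightarrow> 'k::field) set) matsuo_algebra"
proof (rule submodule_matsuoI)
  fix f g :: "point \<Rightarrow> 'k" and c :: 'k
  show "(\<lambda>z. 0 :: 'k) \<in> aug_ideal_sq" by (simp add: aug_ideal_sq_def row_sum_def)
  assume f: "f \<in> aug_ideal_sq"
  have smult: "row_sum (\<lambda>z. c * f z) i = c * row_sum f i" for f i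
    by (simp add: row_sum_def sum_distrib_left)
  show "(\<lambda>z. c * f z) \<in> aug_ideal_sq"
    unfolding aug_ideal_sq_def mem_Collect_eq comp_def smult
    using aug_ideal_sq_row_sums[OF f] unfolding comp_def by metis
  assume g: "g \<in> aug_ideal_sq"
  have add: "row_sum (\<lambda>z. f z + g z) i = row_sum f i + row_sum g i" for f g :: "point \<Rightarrow> 'k" and i
    by (simp add: row_sum_def sum.distrib)
  show "(\<lambda>z. f z + g z) \<in> aug_ideal_sq"
    unfolding aug_ideal_sq_def mem_Collect_eq comp_def add
    using aug_ideal_sq_row_sums[OF f] aug_ideal_sq_row_sums[OF g]
    unfolding comp_def by metis
qed

lemma submodule_const_ideal:
  "LinearCombinations.submodule class_ring (const_ideal :: (point \<Rightarrow> 'k::field) set) matsuo_algebra"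
  by (rule submodule_matsuoI) (auto simp: const_ideal_def)

section \<open>Dimensions by dual bases, and affine relations between points\<close>

lemma subspace_dim_matsuo:
  fixes W :: "(point \<Rightarrow> 'k::field) set"
  assumes W: "LinearCombinations.submodule class_ring W matsuo_algebra"
    and w: "\<And>p. p \<in> I \<Longrightarrow> w p \<in> W"
    and dual: "\<And>p q. p \<in> I \<Longrightarrow> q \<in> I \<Longrightarrow> w p q = (if p = q then 1 else 0)"
    and sep: "\<And>f. f \<in> W \<Longrightarrow> (\<And>p. p \<in> I \<Longrightarrow> f p = 0) \<Longrightarrow> f = (\<lambda>z. 0)"
  shows "subspace_dim class_ring matsuo_algebra W = card I"
proof -
  have "subspace class_ring W matsuo_algebra"
    by (intro subspace.intro vectorspace_matsuo W)
  then have "vectorspace class_ring (matsuo_algebra\<lparr>carrier := W\<rparr>)"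
    by (rule vectorspace.subspace_is_vs[OF vectorspace_matsuo])
  then show ?thesis unfolding subspace_dim_def
    by (rule dim_pointwise(2)[where w = w]) (use assms in auto)
qed

lemma dim_matsuo:
  "vectorspace.fin_dim class_ring (matsuo_algebra :: ('k::field, point \<Rightarrow> 'k) module)"
  "vectorspace.dim class_ring (matsuo_algebra :: ('k::field, point \<Rightarrow> 'k) module) = 9"
proof -
  let ?V = "matsuo_algebra :: ('k, point \<Rightarrow> 'k) module"
  have sep: "f = (\<lambda>z. 0)" if "\<And>p. p \<in> UNIV \<Longrightarrow> f p = 0" for f :: "point \<Rightarrow> 'k"
    using that by blast
  note dim = dim_pointwise[OF vectorspace_matsuo matsuo_simps(2-4) finite, of UNIV point_vector, OF _ _ sep]
  show "vectorspace.fin_dim class_ring ?V"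
    by (rule dim(1)) (simp_all add: point_vector_def)
  have "vectorspace.dim class_ring ?V = card (UNIV :: point set)"
    by (rule dim(2)) (simp_all add: point_vector_def)
  then show "vectorspace.dim class_ring ?V = 9" by simp
qed

lemma dim_aug_ideal: "subspace_dim class_ring matsuo_algebra (aug_ideal :: (point \<Rightarrow> 'k::field) set) = 8"
proof -
  have "subspace_dim class_ring matsuo_algebra (aug_ideal :: (point \<Rightarrow> 'k::field) set) = card (UNIV - {0 :: point})"
  \<comment> \<open>The differences of nonzero points and the origin are dual to evaluation at the
    nonzero points; those values determine the value at the origin because the total is 0.\<close>
  proof (rule subspace_dim_matsuo[OF submodule_aug_ideal, where w = "\<lambda>p z. point_vector p z - point_vector 0 z"])
    fix p :: point
    show "(\<lambda>z. point_vector p z - point_vector 0 z :: 'k) \<in> aug_ideal"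
      by (simp add: aug_ideal_def sum_subtractf point_vector_def)
  next
    fix f :: "point \<Rightarrow> 'k" assume f: "f \<in> aug_ideal" "\<And>p. p \<in> UNIV - {0} \<Longrightarrow> f p = 0"
    then have "sum f UNIV = f 0" by (subst sum.remove[of _ 0]) auto
    then have "f 0 = 0" using f(1) by (simp add: aug_ideal_def)
    then have "f p = 0" for p using f(2)[of p] by (cases "p = 0") simp_all
    then show "f = (\<lambda>z. 0)" ..
  qed (auto simp: point_vector_def)
  also have "\<dots> = 8" by (simp add: card_Diff_subset)
  finally show ?thesis .
qed

lemma dim_const_ideal: "subspace_dim class_ring matsuo_algebra (const_ideal :: (point \<Rightarrow> 'k::field) set) = 1"
proof -
  have "subspace_dim class_ring matsuo_algebra (const_ideal :: (point \<Rightarrow> 'k::field) set) = card {0 :: point}"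
    by (rule subspace_dim_matsuo[OF submodule_const_ideal, where w = "\<lambda>p z. 1"])
       (auto simp: const_ideal_def)
  then show ?thesis by simp
qed

text \<open>
  \<open>affine_relation p\<close> expresses \<open>p\<close> as an affine combination of the frame \<open>(0, 0)\<close>, \<open>(1, 0)\<close>, \<open>(0, 1)\<close>;
  for \<open>p\<close> off the frame these vectors are a basis of \<^const>\<open>aug_ideal_sq\<close>.
\<close>

definition lift_3 :: "3 \<Rightarrow> 'k::field" where
  "lift_3 i = (if i = 0 then 0 else if i = 1 then 1 else - 1)"

definition affine_relation :: "point \<Rightarrow> point \<Rightarrow> 'k::field" where
  "affine_relation p z = point_vector p z - (1 - lift_3 (fst p) - lift_3 (snd p)) * point_vector 0 z
    - lift_3 (fst p) * point_vector (1, 0) z - lift_3 (snd p) * point_vector (0, 1) z"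

definition off_frame :: "point set" where
  "off_frame = UNIV - {(0, 0), (1, 0), (0, 1)}"

lemma point_vector_Pair: "point_vector (a, b) (i, j) = (if i = a \<and> j = b then 1 else 0)"
  by (simp add: point_vector_def)

lemma sum_point_vector_left: "(\<Sum>x\<in>UNIV. point_vector u x * f x) = (f u :: 'k::field)"
  by (simp add: point_vector_def if_distrib[of "\<lambda>a. a * _"] cong: if_cong)

lemma sum_point_vector_1: "sum (point_vector u) UNIV = (1 :: 'k::field)"
  by (simp add: point_vector_def)

lemma point_vector_eqI: "(z = u) = (z' = u') \<Longrightarrow> point_vector u z = point_vector u' z'"
  by (simp add: point_vector_def)

lemma ideal_square_submodule:
  "LinearCombinations.submodule class_ring (ideal_square class_ring matsuo_algebra (I :: (point \<Rightarrow> 'k::field) set)) matsuo_algebra"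
  unfolding ideal_square_def by (rule module.span_is_submodule[OF module_matsuo]) simp

lemma mult_in_ideal_square:
  fixes f g :: "point \<Rightarrow> 'k::field"
  assumes "f \<in> I" "g \<in> I"
  shows "mult matsuo_algebra f g \<in> ideal_square class_ring matsuo_algebra I"
  unfolding ideal_square_def
  by (rule module.in_own_span[OF module_matsuo, THEN subsetD]) (use assms in auto)

lemma ideal_square_subset:
  fixes I :: "(point \<Rightarrow> 'k::field) set"
  assumes "LinearCombinations.submodule class_ring N matsuo_algebra"
    and "\<And>f g. f \<in> I \<Longrightarrow> g \<in> I \<Longrightarrow> mult matsuo_algebra f g \<in> N"
  shows "ideal_square class_ring matsuo_algebra I \<subseteq> N"
  unfolding ideal_square_def
  by (rule module.span_is_subset[OF module_matsuo _ assms(1)]) (use assms(2) in blast)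

lemma const_ideal_eq: "const_ideal = range (\<lambda>c z. c)"
  by (auto simp: const_ideal_def fun_eq_iff)

lemma const_ideal_subset: "const_ideal \<subseteq> aug_ideal_sq"
  by (auto simp: const_ideal_eq aug_ideal_sq_def row_sum_def)

section \<open>The quotient by the augmentation ideal\<close>

text \<open>The fibres of the augmentation are the cosets of the augmentation ideal, so indexing
  cosets by scalars turns the quotient operations into operations of the field.\<close>

definition aug_fibre :: "'k::field \<Rightarrow> (point \<Rightarrow> 'k) set" where
  "aug_fibre c = {f. sum f UNIV = c}"

abbreviation residue_algebra :: "('k::field, (point \<Rightarrow> 'k) set) module" where
  "residue_algebra \<equiv> quotient_algebra matsuo_algebra aug_ideal"

lemma ex_sum: "\<exists>f :: point \<Rightarrow> 'k::field. sum f UNIV = c"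
  by (rule exI[of _ "\<lambda>z. c * point_vector 0 z"]) (simp add: sum_point_vector_1 flip: sum_distrib_left)

lemma inj_aug_fibre: "inj (aug_fibre :: 'k::field \<Rightarrow> _)"
proof (rule injI)
  fix c d :: 'k assume "aug_fibre c = aug_fibre d"
  moreover obtain f :: "point \<Rightarrow> 'k" where "sum f UNIV = c" using ex_sum by blast
  ultimately show "c = d" by (auto simp: aug_fibre_def)
qed

lemma aug_coset: "a_r_coset matsuo_algebra aug_ideal f = aug_fibre (sum f UNIV)"
proof
  show "a_r_coset matsuo_algebra aug_ideal f \<subseteq> aug_fibre (sum f UNIV)"
    by (auto simp: a_r_coset_def' aug_ideal_def aug_fibre_def sum.distrib)
  show "aug_fibre (sum f UNIV) \<subseteq> a_r_coset matsuo_algebra aug_ideal f"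
  proof
    fix g assume "g \<in> aug_fibre (sum f UNIV)"
    then have "(\<lambda>z. g z - f z) \<in> aug_ideal" by (simp add: aug_fibre_def aug_ideal_def sum_subtractf)
    then show "g \<in> a_r_coset matsuo_algebra aug_ideal f"
      unfolding a_r_coset_def' by (intro UN_I) (auto simp: fun_eq_iff)
  qed
qed

lemma residue_carrier: "carrier (residue_algebra :: ('k::field, _) module) = range aug_fibre"
proof -
  have "carrier (residue_algebra :: ('k, _) module) = (\<Union>f :: point \<Rightarrow> 'k. {aug_fibre (sum f UNIV)})"
    by (simp add: quotient_algebra_def ring.extend_def FactRing_def A_RCOSETS_def' aug_coset)
  also have "\<dots> = aug_fibre ` range (\<lambda>f :: point \<Rightarrow> 'k. sum f UNIV)" by blast
  also have "range (\<lambda>f :: point \<Rightarrow> 'k. sum f UNIV) = UNIV" unfolding surj_def by (metis ex_sum)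
  finally show ?thesis .
qed

lemma residue_zero: "zero residue_algebra = aug_fibre 0"
  by (simp add: quotient_algebra_def ring.extend_def FactRing_def aug_fibre_def aug_ideal_def)

lemma residue_add: "add residue_algebra (aug_fibre c) (aug_fibre d) = aug_fibre (c + d)"
  for c d :: "'k::field"
proof
  have eq: "add residue_algebra (aug_fibre c) (aug_fibre d) = (\<Union>f\<in>aug_fibre c. \<Union>g\<in>aug_fibre d. {\<lambda>z. f z + g z})"
    by (simp add: quotient_algebra_def ring.extend_def FactRing_def set_add_def')
  show "add residue_algebra (aug_fibre c) (aug_fibre d) \<subseteq> aug_fibre (c + d)"
    unfolding eq by (auto simp: aug_fibre_def sum.distrib)
  show "aug_fibre (c + d) \<subseteq> add residue_algebra (aug_fibre c) (aug_fibre d)"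
  proof
    fix h assume h: "h \<in> aug_fibre (c + d)"
    obtain f :: "point \<Rightarrow> 'k" where f: "sum f UNIV = c" using ex_sum by blast
    have "(\<lambda>z. h z - f z) \<in> aug_fibre d" using h f by (simp add: aug_fibre_def sum_subtractf)
    moreover have "f \<in> aug_fibre c" using f by (simp add: aug_fibre_def)
    ultimately show "h \<in> add residue_algebra (aug_fibre c) (aug_fibre d)"
      unfolding eq by (intro UN_I) auto
  qed
qed

lemma residue_smult: "smult residue_algebra a (aug_fibre c) = aug_fibre (a * c)"
proof -
  have "smult residue_algebra a (aug_fibre c) = (\<Union>f\<in>aug_fibre c. aug_fibre (a * c))"
    by (simp add: quotient_algebra_def ring.extend_def module.fields_def aug_coset aug_fibre_def
        flip: sum_distrib_left)
  \<comment> \<open>The union of copies of one set equals that set only because the fibre is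
    nonempty.\<close>
  then show ?thesis using ex_sum[of c] by (auto simp: aug_fibre_def[of c])
qed

section \<open>Characteristic 3\<close>

context
  assumes char3: "CHAR('k::field) = 3"
begin

section \<open>The Matsuo product as a reflected convolution\<close>

lemma three_eq_0: "(3::'k) = 0"
  using of_nat_CHAR[where ?'a = 'k] char3 by simp

lemma matsuo_basis_mult_eq:
  "matsuo_basis_mult x y z = (point_vector x z + point_vector y z - point_vector (- (x + y)) z :: 'k)"
proof -
  have "(4::'k) = 3 + 1" by simp
  then have "(4::'k) = 1" by (simp only: three_eq_0) simp
  moreover have "- (x + x) = x" by (simp add: minus_double)
  ultimately show ?thesis
    by (auto simp: matsuo_basis_mult_def third_point_eq)
qed

text \<open>The three summands of a product of points extend to two augmentation terms and a
  convolution at -z; the latter is a single sum because z = -(x + y) determines y.\<close>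

lemma matsuo_mult:
  "mult matsuo_algebra f g z = sum g UNIV * f z + sum f UNIV * g z - (\<Sum>x\<in>UNIV. f x * g (- z - x) :: 'k)"
proof -
  have "mult matsuo_algebra f g z = (\<Sum>x\<in>UNIV. \<Sum>y\<in>UNIV. f x * g y * matsuo_basis_mult x y z)"
    by (simp add: matsuo_algebra_def)
  also have "\<dots> = (\<Sum>x\<in>UNIV. \<Sum>y\<in>UNIV. f x * g y * point_vector x z)
     + (\<Sum>x\<in>UNIV. \<Sum>y\<in>UNIV. f x * g y * point_vector y z)
     - (\<Sum>x\<in>UNIV. \<Sum>y\<in>UNIV. f x * g y * point_vector (- (x + y)) z)"
    by (simp add: matsuo_basis_mult_eq algebra_simps sum.distrib sum_subtractf)
  also have "(\<Sum>x\<in>UNIV. \<Sum>y\<in>UNIV. f x * g y * point_vector x z)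
      = (\<Sum>x\<in>UNIV. f x * point_vector x z) * sum g UNIV"
    by (simp add: sum_distrib_left sum_distrib_right mult_ac)
  also have "(\<Sum>x\<in>UNIV. \<Sum>y\<in>UNIV. f x * g y * point_vector y z)
      = sum f UNIV * (\<Sum>y\<in>UNIV. g y * point_vector y z)"
    by (simp add: sum_product mult_ac)
  also have "(\<Sum>x\<in>UNIV. \<Sum>y\<in>UNIV. f x * g y * point_vector (- (x + y)) z) = (\<Sum>x\<in>UNIV. f x * g (- z - x))"
  proof (rule sum.cong[OF refl])
    fix x
    have "(z = - (x + y)) = (y = - z - x)" for y :: point
      by (metis eq_diff_eq add.commute minus_minus)
    then show "(\<Sum>y\<in>UNIV. f x * g y * point_vector (- (x + y)) z) = f x * g (- z - x)"
      by (simp add: point_vector_def if_distrib[of "\<lambda>a. _ * a"] cong: if_cong)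
  qed
  finally show ?thesis by (simp add: sum_point_vector mult.commute)
qed

text \<open>Each linear term contributes the product of the augmentations, and the convolution
  subtracts it once.\<close>

lemma sum_matsuo_mult:
  "sum (mult matsuo_algebra f g) UNIV = (sum f UNIV * sum g UNIV :: 'k)"
proof -
  have "(\<Sum>z\<in>UNIV. \<Sum>x\<in>UNIV. f x * g (- z - x)) = (\<Sum>x\<in>UNIV. f x * (\<Sum>z\<in>UNIV. g (- x - z)))"
    by (subst sum.swap) (simp add: sum_distrib_left minus_diff_commute)
  also have "\<dots> = sum f UNIV * sum g UNIV"
    by (simp add: sum_reflect sum_distrib_right)
  finally show ?thesis
    by (simp add: matsuo_mult sum.distrib sum_subtractf flip: sum_distrib_left)
qed

text \<open>Inversion is a ring involution, so the second formula is the first with the roles of the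
  original and inverted functions exchanged. Having both allows nested products to be expanded by
  rewriting.\<close>

lemma grp_matsuo_mult:
  fixes f g :: "point \<Rightarrow> 'k"
  shows "grp (mult matsuo_algebra f g) = Poly_Mapping.single 0 (sum g UNIV) * grp f
     + Poly_Mapping.single 0 (sum f UNIV) * grp g - grp (f \<circ> uminus) * grp (g \<circ> uminus)" (is ?A)
  and "grp (mult matsuo_algebra f g \<circ> uminus) = Poly_Mapping.single 0 (sum g UNIV) * grp (f \<circ> uminus)
     + Poly_Mapping.single 0 (sum f UNIV) * grp (g \<circ> uminus) - grp f * grp g" (is ?B)
proof -
  have "(\<Sum>x\<in>UNIV. f (- x) * g (- (z - x))) = (\<Sum>x\<in>UNIV. f x * g (- z - x))" for z
    using sum_neg[of "\<lambda>x. f x * g (- z - x)"] by (simp add: algebra_simps)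
  then show ?A
    by (intro poly_mapping_eqI)
       (simp add: matsuo_mult lookup_add lookup_minus lookup_single_0_mult lookup_mult_finite[of "grp _" "grp _"])
  show ?B
    by (intro poly_mapping_eqI)
       (simp add: matsuo_mult lookup_add lookup_minus lookup_single_0_mult lookup_mult_finite[of "grp _" "grp _"])
qed

section \<open>Frobenius on the group algebra and the Jordan identity\<close>

lemma CHAR_grp: "CHAR(point \<Rightarrow>\<^sub>0 'k) = 3"
proof (rule CHAR_eqI)
  show "of_nat 3 = (0 :: point \<Rightarrow>\<^sub>0 'k)"
    using three_eq_0 by (simp flip: single_numeral)
  fix n assume "of_nat n = (0 :: point \<Rightarrow>\<^sub>0 'k)"
  then have "Poly_Mapping.single (0::point) (of_nat n :: 'k) = Poly_Mapping.single 0 0"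
    by (simp only: single_of_nat single_zero)
  then have "(of_nat n :: 'k) = 0" by (metis lookup_single_eq)
  then show "3 dvd n" using char3 by (simp add: of_nat_eq_0_iff_char_dvd)
qed

text \<open>Cubing is additive in characteristic 3, and each point cubes to the identity of the
  group algebra because p + p + p = 0.\<close>

lemma grp_cube: "grp f ^ 3 = Poly_Mapping.single 0 (sum f UNIV ^ 3)" for f :: "point \<Rightarrow> 'k"
proof -
  have "grp f = (\<Sum>p\<in>UNIV. Poly_Mapping.single p (f p))"
    by (intro poly_mapping_eqI) (simp add: lookup_sum lookup_single when_def)
  then have "grp f ^ 3 = (\<Sum>p\<in>UNIV. Poly_Mapping.single p (f p) ^ 3)"
    using CHAR_grp by (simp add: freshmans_dream_sum)
  also have "\<dots> = (\<Sum>p\<in>UNIV. Poly_Mapping.single 0 (f p ^ 3))"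
    using three_point by (intro sum.cong) (simp_all add: power3_eq_cube mult_single)
  also have "\<dots> = Poly_Mapping.single 0 (\<Sum>p\<in>UNIV. f p ^ 3)"
    by (intro poly_mapping_eqI) (simp add: lookup_sum lookup_single when_def)
  also have "(\<Sum>p\<in>UNIV. f p ^ 3) = sum f UNIV ^ 3"
    using char3 by (simp add: freshmans_dream_sum)
  finally show ?thesis .
qed

lemma matsuo_comm: "mult matsuo_algebra f g = mult matsuo_algebra g (f :: point \<Rightarrow> 'k)"
  by (simp add: grp_inject[symmetric] grp_matsuo_mult algebra_simps)

lemma matsuo_jordan:
  fixes a b :: "point \<Rightarrow> 'k"
  defines "m \<equiv> mult matsuo_algebra"
  shows "m (m a b) (m a a) = m a (m b (m a a))"
proof -
  \<comment> \<open>Splitting embedded scalars into factors brings both sides literally into the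
    shape of \<open>twisted_jordan\<close>.\<close>
  have hom: "Poly_Mapping.single (0::point) (c * d) = Poly_Mapping.single 0 c * Poly_Mapping.single 0 (d::'k)" for c d
    by (simp add: mult_single)
  \<comment> \<open>A cube depends only on the augmentation, which inversion preserves.\<close>
  have "grp a ^ 3 = grp (a \<circ> uminus) ^ 3"
    using sum_neg[of a] by (simp add: grp_cube)
  then have "grp (m (m a b) (m a a)) = grp (m a (m b (m a a)))"
    unfolding m_def grp_matsuo_mult sum_matsuo_mult hom by (rule twisted_jordan)
  then show ?thesis by (simp add: grp_inject)
qed

lemma jordan_algebra_matsuo: "jordan_algebra class_ring (matsuo_algebra :: ('k, point \<Rightarrow> 'k) module)"
proof (intro jordan_algebra.intro nonassoc_algebra.intro jordan_algebra_axioms.intro vectorspace_matsuo)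
  fix f g h :: "point \<Rightarrow> 'k" and c :: 'k
  let ?M = "matsuo_algebra :: ('k, point \<Rightarrow> 'k) module"
  show distr: "(f \<oplus>\<^bsub>?M\<^esub> g) \<otimes>\<^bsub>?M\<^esub> h = f \<otimes>\<^bsub>?M\<^esub> h \<oplus>\<^bsub>?M\<^esub> g \<otimes>\<^bsub>?M\<^esub> h"
    by (simp add: matsuo_mult fun_eq_iff sum.distrib algebra_simps)
  show smult: "(c \<odot>\<^bsub>?M\<^esub> f) \<otimes>\<^bsub>?M\<^esub> h = c \<odot>\<^bsub>?M\<^esub> (f \<otimes>\<^bsub>?M\<^esub> h)"
    by (simp add: matsuo_mult fun_eq_iff algebra_simps sum_distrib_left)
  show "h \<otimes>\<^bsub>?M\<^esub> (f \<oplus>\<^bsub>?M\<^esub> g) = h \<otimes>\<^bsub>?M\<^esub> f \<oplus>\<^bsub>?M\<^esub> h \<otimes>\<^bsub>?M\<^esub> g"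
    unfolding matsuo_comm[of h] by (rule distr)
  show "h \<otimes>\<^bsub>?M\<^esub> (c \<odot>\<^bsub>?M\<^esub> f) = c \<odot>\<^bsub>?M\<^esub> (h \<otimes>\<^bsub>?M\<^esub> f)"
    unfolding matsuo_comm[of h] by (rule smult)
qed (simp, rule matsuo_comm, rule matsuo_jordan)

text \<open>Several cancellations below exhibit a difference as an explicit multiple of 3, which
  this equation then removes.\<close>

lemma triple: "3 * x = (0::'k)"
  using three_eq_0 by simp

section \<open>Row sums of products\<close>

lemma matsuo_mult_swap:
  "mult matsuo_algebra (f \<circ> prod.swap) (g \<circ> prod.swap) = mult matsuo_algebra f (g :: point \<Rightarrow> 'k) \<circ> prod.swap"
proof
  fix z :: point
  have "(\<Sum>x\<in>UNIV. f (prod.swap x) * g (prod.swap (- z - x))) = (\<Sum>x\<in>UNIV. f x * g (- prod.swap z - x))"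
    using sum_swap_point[of "\<lambda>x. f x * g (- prod.swap z - x)"] by (simp add: prod.swap_def minus_prod_def uminus_prod_def)
  then show "mult matsuo_algebra (f \<circ> prod.swap) (g \<circ> prod.swap) z = (mult matsuo_algebra f g \<circ> prod.swap) z"
    by (simp add: matsuo_mult sum_swap_point)
qed

text \<open>Projection to one coordinate respects convolution, so row sums multiply by the Matsuo
  formula on the cyclic group of order 3.\<close>

lemma row_sum_matsuo_mult:
  fixes f g :: "point \<Rightarrow> 'k"
  shows "row_sum (mult matsuo_algebra f g) i = sum g UNIV * row_sum f i + sum f UNIV * row_sum g i
    - (\<Sum>a\<in>UNIV. row_sum f a * row_sum g (- i - a))"
proof -
  have "(\<Sum>j\<in>UNIV. g (- (i, j) - x)) = row_sum g (- i - fst x)" for x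
  proof -
    have "- (i, j) - x = (- i - fst x, - snd x - j)" for j
      by (simp add: prod_eq_iff)
    then show ?thesis
      using sum_reflect_3[of "\<lambda>j. g (- i - fst x, j)"] by (simp add: row_sum_def)
  qed
  then have "(\<Sum>j\<in>UNIV. \<Sum>x\<in>UNIV. f x * g (- (i, j) - x)) = (\<Sum>x\<in>UNIV. f x * row_sum g (- i - fst x))"
    by (subst sum.swap) (simp add: sum_distrib_left[symmetric])
  also have "\<dots> = (\<Sum>a\<in>UNIV. row_sum f a * row_sum g (- i - a))"
    by (simp add: sum_point row_sum_def[of f] sum_distrib_right)
  finally show ?thesis
    by (simp add: row_sum_def[of "mult _ _ _"] matsuo_mult sum.distrib sum_subtractf flip: sum_distrib_left)
       (simp add: row_sum_def)
qed

lemma aug_ideal_sq_subset: "aug_ideal_sq \<subseteq> (aug_ideal :: (point \<Rightarrow> 'k) set)"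
proof
  fix f :: "point \<Rightarrow> 'k" assume "f \<in> aug_ideal_sq"
  then have "sum f UNIV = (\<Sum>i\<in>(UNIV::3 set). row_sum f 0)"
    unfolding sum_row_sum by (intro sum.cong) (auto simp: aug_ideal_sq_def)
  also have "\<dots> = 3 * row_sum f 0" by (simp add: sum_3)
  finally show "f \<in> aug_ideal" by (simp add: triple aug_ideal_def)
qed

text \<open>With constant row sums \<rho> and augmentation 0 for \<open>f\<close>, the row sums of
  the product vanish: the linear term and the convolution both equal \<rho> times the augmentation
  of \<open>g\<close>.\<close>

lemma matsuo_mult_aug_sq_left:
  fixes f g :: "point \<Rightarrow> 'k"
  assumes "f \<in> aug_ideal_sq"
  shows "mult matsuo_algebra f g \<in> aug_ideal_sq"
proof -
  have *: "row_sum (mult matsuo_algebra f g) i = 0" if "f \<in> aug_ideal_sq" for f g :: "point \<Rightarrow> 'k" and i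
  proof -
    define \<rho> where "\<rho> = row_sum f 0"
    have "row_sum f = (\<lambda>_. \<rho>)" using that unfolding aug_ideal_sq_def \<rho>_def by blast
    moreover have "sum f UNIV = 0" using that aug_ideal_sq_subset by (auto simp: aug_ideal_def)
    moreover have "(\<Sum>a\<in>UNIV. row_sum g (- i - a)) = sum g UNIV"
      unfolding sum_row_sum[of g] by (rule sum_reflect_3)
    ultimately show ?thesis
      by (simp add: row_sum_matsuo_mult sum_distrib_left[symmetric])
  qed
  have "row_sum (mult matsuo_algebra f g \<circ> prod.swap) i = 0" for i
    using *[of "f \<circ> prod.swap" "g \<circ> prod.swap"] assms
    by (simp add: swap_in_aug_ideal_sq matsuo_mult_swap)
  with *[OF assms] show ?thesis by (simp add: aug_ideal_sq_def)
qed

text \<open>The group algebra of the cyclic group of order 3 is a truncated polynomial ring with s^3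
  = 0. Its augmentation ideal is (s), whose square (s^2) consists of constant functions since s^2 =
  1 + x + x^2 for s = x - 1.\<close>

lemma cyclic_convolution_const:
  fixes r s :: "3 \<Rightarrow> 'k"
  assumes "sum r UNIV = 0" "sum s UNIV = 0"
  shows "(\<Sum>a\<in>UNIV. r a * s (c - a)) = (\<Sum>a\<in>UNIV. r a * s (- a))"
proof -
  have r: "r 0 = - r 1 - r 2" and s: "s 0 = - s 1 - s 2"
    using assms by (simp_all add: sum_3 add_eq_0_iff algebra_simps)
  have "r 0 * s 1 + r 1 * s 0 + r 2 * s 2 - (r 0 * s 0 + r 1 * s 2 + r 2 * s 1) = 3 * (- r 1 * s 1 - r 1 * s 2 - r 2 * s 1)"
     "r 0 * s 2 + r 1 * s 1 + r 2 * s 0 - (r 0 * s 0 + r 1 * s 2 + r 2 * s 1) = 3 * (- r 1 * s 2 - r 2 * s 1 - r 2 * s 2)"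
    unfolding r s by (simp_all add: algebra_simps)
  then have "r 0 * s 1 + r 1 * s 0 + r 2 * s 2 = r 0 * s 0 + r 1 * s 2 + r 2 * s 1"
    "r 0 * s 2 + r 1 * s 1 + r 2 * s 0 = r 0 * s 0 + r 1 * s 2 + r 2 * s 1"
    unfolding triple by simp_all
  then show ?thesis using in_3_cases[of c] by (auto simp: sum_3 arith_3)
qed

lemma matsuo_mult_aug:
  fixes f g :: "point \<Rightarrow> 'k"
  assumes "f \<in> aug_ideal" "g \<in> aug_ideal"
  shows "mult matsuo_algebra f g \<in> aug_ideal_sq"
proof -
  have *: "row_sum (mult matsuo_algebra f g) i = row_sum (mult matsuo_algebra f g) 0"
    if "f \<in> aug_ideal" "g \<in> aug_ideal" for f g :: "point \<Rightarrow> 'k" and i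
    using that cyclic_convolution_const[of "row_sum f" "row_sum g" "- i"]
    by (simp add: row_sum_matsuo_mult aug_ideal_def sum_row_sum[symmetric])
  show ?thesis
    using *[OF assms] *[of "f \<circ> prod.swap" "g \<circ> prod.swap"] assms
    by (auto simp: aug_ideal_sq_def aug_ideal_def sum_swap_point matsuo_mult_swap)
qed

section \<open>The product on the square of the augmentation ideal\<close>

lemma aug_ideal_sq_orthogonal:
  fixes g :: "point \<Rightarrow> 'k"
  assumes "g \<in> aug_ideal_sq" "sum A UNIV = 0" "sum B UNIV = 0"
  shows "(\<Sum>p\<in>UNIV. g p * (A (fst p) + B (snd p))) = 0"
proof -
  note g = aug_ideal_sq_row_sums[OF assms(1)]
  have "(\<Sum>p\<in>UNIV. g p * A (fst p)) = (\<Sum>i\<in>UNIV. row_sum g i * A i)"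
    by (simp add: sum_point row_sum_def sum_distrib_right)
  \<comment> \<open>All rows have the same sum, which factors out and leaves the total of
    \<open>A\<close>; columns treat \<open>B\<close> likewise.\<close>
  also have "\<dots> = row_sum g 0 * sum A UNIV"
    unfolding sum_distrib_left by (intro sum.cong refl arg_cong2[where f = times] g)
  finally have 1: "(\<Sum>p\<in>UNIV. g p * A (fst p)) = 0" using assms by simp
  have "(\<Sum>p\<in>UNIV. g p * B (snd p)) = (\<Sum>i\<in>UNIV. row_sum (g \<circ> prod.swap) i * B i)"
    unfolding sum_point by (subst sum.swap) (simp add: row_sum_def sum_distrib_right)
  also have "\<dots> = row_sum (g \<circ> prod.swap) 0 * sum B UNIV"
    unfolding sum_distrib_left by (intro sum.cong refl arg_cong2[where f = times] g)
  finally have 2: "(\<Sum>p\<in>UNIV. g p * B (snd p)) = 0" using assms by simp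
  from 1 2 show ?thesis by (simp add: distrib_left sum.distrib)
qed

text \<open>
  Elements of the square are polynomial functions of degree at most 2, so their differences are
  affine, and those are orthogonal to the square.
\<close>

lemma aug_ideal_sq_difference:
  fixes f :: "point \<Rightarrow> 'k"
  assumes f: "f \<in> aug_ideal_sq"
  obtains A B where "\<And>p. f (p + (1, 0)) - f p = A (fst p) + B (snd p)" "sum A UNIV = 0" "sum B UNIV = 0"
proof -
  define h where "h i j = f (i + 1, j) - f (i, j)" for i j
  define C where "C = row_sum (f \<circ> prod.swap) 0"
  have C: "f (0, j) + f (1, j) + f (2, j) = C" for j
    using f unfolding aug_ideal_sq_def C_def row_sum_def by (simp add: sum_3)
  \<comment> \<open>Modulo 3 the second difference in the first direction is the common column sum
    \<open>C\<close>, independent of \<open>j\<close>. Hence \<open>h\<close> splits into a function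
    of \<open>i\<close> plus a function of \<open>j\<close>.\<close>
  have "h 1 j - h 0 j = C - 3 * f (1, j)" "h 2 j - h 1 j = C - 3 * f (2, j)" for j
    using C[of j] by (simp_all add: h_def arith_3 algebra_simps)
  then have h: "h 1 j = h 0 j + C" "h 2 j = h 0 j + C + C" for j
    unfolding triple by (auto simp: algebra_simps)
  define A where "A i = h i 0 - h 0 0" for i
  have "h i j = A i + h 0 j" for i j
    using in_3_cases[of i] h by (auto simp: A_def)
  then have "f (p + (1, 0)) - f p = A (fst p) + h 0 (snd p)" for p
    by (cases p) (simp add: h_def)
  moreover have "sum A UNIV = 3 * C" unfolding A_def by (simp add: sum_3 h)
  then have "sum A UNIV = 0" unfolding triple .
  moreover have "row_sum f 1 = row_sum f 0" using f unfolding aug_ideal_sq_def by blast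
  then have "sum (h 0) UNIV = 0" by (simp add: sum_subtractf row_sum_def h_def)
  ultimately show thesis by (rule that)
qed

text \<open>A shift changes the convolution by the pairing of \<open>f\<close> with a reflected
  difference of \<open>g\<close>, and such differences are orthogonal to the square.\<close>

lemma convolution_shift:
  fixes f g :: "point \<Rightarrow> 'k"
  assumes f: "f \<in> aug_ideal_sq" and g: "g \<in> aug_ideal_sq"
  shows "(\<Sum>x\<in>UNIV. f x * g (u + (1, 0) - x)) = (\<Sum>x\<in>UNIV. f x * g (u - x))"
proof -
  obtain A B where AB: "\<And>p. g (p + (1, 0)) - g p = A (fst p) + B (snd p)" "sum A UNIV = 0" "sum B UNIV = 0"
    using aug_ideal_sq_difference[OF g] by blast
  have "(\<Sum>x\<in>UNIV. f x * g (u + (1, 0) - x)) - (\<Sum>x\<in>UNIV. f x * g (u - x))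
     = (\<Sum>x\<in>UNIV. f x * (g ((u - x) + (1, 0)) - g (u - x)))"
    by (simp add: sum_subtractf right_diff_distrib add_diff_eq diff_add_eq)
  also have "\<dots> = (\<Sum>x\<in>UNIV. f x * (A (fst u - fst x) + B (snd u - snd x)))"
    unfolding AB(1) by simp
  also have "\<dots> = 0"
    by (rule aug_ideal_sq_orthogonal[OF f, of "\<lambda>i. A (fst u - i)" "\<lambda>i. B (snd u - i)"])
       (simp_all add: sum_reflect_3 AB)
  finally show ?thesis by simp
qed

text \<open>The odd part of a polynomial function of degree at most 2 is linear. Here this follows
  from comparing rows 1 and 2 and columns 1 and 2.\<close>

lemma odd_part_additive:
  fixes f :: "point \<Rightarrow> 'k"
  assumes f: "f \<in> aug_ideal_sq"
  defines "\<phi> \<equiv> \<lambda>p. f p - f (- p)"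
  shows "\<phi> (1, 1) = \<phi> (1, 0) + \<phi> (0, 1)" "\<phi> (1, 2) = \<phi> (1, 0) - \<phi> (0, 1)"
proof -
  have r: "f (1, 0) + f (1, 1) + f (1, 2) - (f (2, 0) + f (2, 1) + f (2, 2)) = 0"
    and c: "f (0, 1) + f (1, 1) + f (2, 1) - (f (0, 2) + f (1, 2) + f (2, 2)) = 0"
    using aug_ideal_sq_row_sums[OF f, of 1] aug_ideal_sq_row_sums[OF f, of 2]
    by (simp_all add: row_sum_def sum_3)
  have "\<phi> (1, 1) - (\<phi> (1, 0) + \<phi> (0, 1)) = 3 * (f (1, 1) - f (2, 2))
      - (f (1, 0) + f (1, 1) + f (1, 2) - (f (2, 0) + f (2, 1) + f (2, 2)))
      - (f (0, 1) + f (1, 1) + f (2, 1) - (f (0, 2) + f (1, 2) + f (2, 2)))"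
    by (simp add: \<phi>_def arith_3 algebra_simps)
  then show "\<phi> (1, 1) = \<phi> (1, 0) + \<phi> (0, 1)" unfolding r c triple by simp
  have "\<phi> (1, 2) - (\<phi> (1, 0) - \<phi> (0, 1)) = 3 * (f (1, 2) - f (2, 1))
      - (f (1, 0) + f (1, 1) + f (1, 2) - (f (2, 0) + f (2, 1) + f (2, 2)))
      + (f (0, 1) + f (1, 1) + f (2, 1) - (f (0, 2) + f (1, 2) + f (2, 2)))"
    by (simp add: \<phi>_def arith_3 algebra_simps)
  then show "\<phi> (1, 2) = \<phi> (1, 0) - \<phi> (0, 1)" unfolding r c triple by simp
qed

text \<open>Grouping the nonzero points into four pairs p, -p turns the difference into a sum of
  four products of \<phi> and \<gamma> values. By additivity, (a + b)(c + d) + (a - b)(c - d) + ac +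
  bd = 3(ac + bd) = 0.\<close>

lemma sum_mult_neg:
  fixes f g :: "point \<Rightarrow> 'k"
  assumes f: "f \<in> aug_ideal_sq" and g: "g \<in> aug_ideal_sq"
  shows "(\<Sum>x\<in>UNIV. f x * g (- x)) = (\<Sum>x\<in>UNIV. f x * g x)"
proof -
  let ?\<phi> = "\<lambda>p. f p - f (- p)" and ?\<gamma> = "\<lambda>p. g p - g (- p)"
  have "(\<Sum>x\<in>UNIV. f x * g x) - (\<Sum>x\<in>UNIV. f x * g (- x))
     = ?\<phi> (1, 0) * ?\<gamma> (1, 0) + ?\<phi> (0, 1) * ?\<gamma> (0, 1) + ?\<phi> (1, 1) * ?\<gamma> (1, 1) + ?\<phi> (1, 2) * ?\<gamma> (1, 2)"
    by (simp add: sum_point sum_3 arith_3 algebra_simps)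
  also have "\<dots> = 3 * (?\<phi> (1, 0) * ?\<gamma> (1, 0) + ?\<phi> (0, 1) * ?\<gamma> (0, 1))"
    unfolding odd_part_additive[OF f] odd_part_additive[OF g] by (simp add: algebra_simps)
  finally show ?thesis unfolding triple by simp
qed

text \<open>The convolution is invariant under both unit shifts, the second by swapping coordinates,
  hence constant; \<open>sum_mult_neg\<close> identifies its value at 0.\<close>

lemma convolution_aug_sq:
  fixes f g :: "point \<Rightarrow> 'k"
  assumes f: "f \<in> aug_ideal_sq" and g: "g \<in> aug_ideal_sq"
  shows "(\<Sum>x\<in>UNIV. f x * g (u - x)) = (\<Sum>x\<in>UNIV. f x * g x)"
proof -
  let ?D = "\<lambda>f g u. \<Sum>x\<in>UNIV. f x * g (u - x)"
  have swap: "?D f g (prod.swap u) = ?D (f \<circ> prod.swap) (g \<circ> prod.swap) u" for f g :: "point \<Rightarrow> 'k" and u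
    using sum_swap_point[of "\<lambda>x. f x * g (prod.swap u - x)"] by (simp add: prod.swap_def minus_prod_def)
  have "?D f g u = ?D f g 0"
  proof (rule shift_invariant_const)
    fix u :: point
    show "?D f g (u + (1, 0)) = ?D f g u" using f g by (rule convolution_shift)
    have "?D f g (prod.swap (prod.swap u + (1, 0))) = ?D f g (prod.swap (prod.swap u))"
      unfolding swap[of f g "prod.swap u + (1, 0)"] swap[of f g "prod.swap u"]
      by (intro convolution_shift swap_in_aug_ideal_sq[THEN iffD2] f g)
    then show "?D f g (u + (0, 1)) = ?D f g u" by (cases u) simp
  qed
  with sum_mult_neg[OF f g] show ?thesis by simp
qed

lemma neg_in_aug_ideal_sq: "f \<circ> uminus \<in> aug_ideal_sq" if "f \<in> aug_ideal_sq" for f :: "point \<Rightarrow> 'k"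
proof -
  have "row_sum (f \<circ> uminus) i = row_sum f (- i)" for f :: "point \<Rightarrow> 'k" and i
    using sum_reflect_3[of "\<lambda>j. f (- i, j)" 0] by (simp add: row_sum_def)
  moreover have "f \<circ> uminus \<circ> prod.swap = f \<circ> prod.swap \<circ> uminus" by (auto simp: fun_eq_iff)
  ultimately show ?thesis using that unfolding aug_ideal_sq_def by simp
qed

lemma matsuo_mult_aug_sq:
  fixes f g :: "point \<Rightarrow> 'k"
  assumes "f \<in> aug_ideal_sq" "g \<in> aug_ideal_sq"
  shows "mult matsuo_algebra f g = (\<lambda>z. - (\<Sum>x\<in>UNIV. f x * g x))"
proof -
  have "sum f UNIV = 0" "sum g UNIV = 0" using assms aug_ideal_sq_subset by (auto simp: aug_ideal_def)
  then show ?thesis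
    by (simp add: fun_eq_iff matsuo_mult convolution_aug_sq assms)
qed

text \<open>A constant has augmentation 9c = 0, and its convolution with \<open>g\<close> is c times
  the augmentation of \<open>g\<close>, which cancels the remaining term.\<close>

lemma matsuo_mult_const:
  "mult matsuo_algebra (\<lambda>z. c) g = (\<lambda>z. 0 :: 'k)"
proof
  fix z
  have "(\<Sum>x\<in>(UNIV::point set). c) = 3 * (3 * c)" by (simp add: sum_point sum_3)
  then have "(\<Sum>x\<in>(UNIV::point set). c) = 0" unfolding triple .
  then show "mult matsuo_algebra (\<lambda>z. c) g z = 0"
    by (simp add: matsuo_mult sum_reflect mult.commute flip: sum_distrib_left del: sum_constant)
qed

text \<open>Both \<open>a\<close> and the product have augmentation 0, so only a convolution
  remains. The product has two parts, a multiple of \<open>a\<close> and a convolution with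
  \<open>b\<close>; each contributes \<open>k\<close> times the augmentation of \<open>b\<close>,
  with opposite signs.\<close>

lemma matsuo_mult_aug_sq_twice:
  fixes a b :: "point \<Rightarrow> 'k"
  assumes a: "a \<in> aug_ideal_sq"
  shows "mult matsuo_algebra a (mult matsuo_algebra a b) = (\<lambda>z. 0)"
proof
  fix z
  define k where "k = (\<Sum>x\<in>UNIV. a x * a x)"
  have sa: "sum a UNIV = 0" using a aug_ideal_sq_subset by (auto simp: aug_ideal_def)
  have ab: "mult matsuo_algebra a b w = sum b UNIV * a w - (\<Sum>y\<in>UNIV. b y * a (- w - y))" for w
    unfolding matsuo_comm[of a b] using sa by (simp add: matsuo_mult)
  \<comment> \<open>All autocorrelations of \<open>a\<close> agree: they are convolutions of
    \<open>a\<close> with its inversion, which also lies in the square.\<close>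
  have corr: "(\<Sum>x\<in>UNIV. a x * a (x + u)) = k" for u
  proof -
    have "(\<Sum>x\<in>UNIV. a x * a (x + u)) = (\<Sum>x\<in>UNIV. a x * (a \<circ> uminus) (- u - x))" by (simp add: add.commute)
    also have "\<dots> = (\<Sum>x\<in>UNIV. a x * a (- x))"
      using convolution_aug_sq[OF a neg_in_aug_ideal_sq[OF a], of "- u"] by simp
    finally show ?thesis using sum_mult_neg[OF a a] by (simp add: k_def)
  qed
  have "(\<Sum>x\<in>UNIV. a x * mult matsuo_algebra a b (- z - x))
    = sum b UNIV * (\<Sum>x\<in>UNIV. a x * a (- z - x)) - (\<Sum>x\<in>UNIV. \<Sum>y\<in>UNIV. b y * (a x * a (x + (z - y))))"
    by (simp add: ab right_diff_distrib sum_subtractf sum_distrib_left mult_ac add_ac add_diff_eq)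
  also have "(\<Sum>x\<in>UNIV. \<Sum>y\<in>UNIV. b y * (a x * a (x + (z - y)))) = sum b UNIV * k"
    by (subst sum.swap) (simp add: corr sum_distrib_left[symmetric] sum_distrib_right[symmetric])
  also have "(\<Sum>x\<in>UNIV. a x * a (- z - x)) = k"
    using convolution_aug_sq[OF a a] by (simp add: k_def)
  finally show "mult matsuo_algebra a (mult matsuo_algebra a b) z = 0"
    unfolding matsuo_mult[of a "mult matsuo_algebra a b"]
    by (simp add: sum_matsuo_mult sa)
qed

section \<open>A basis of the square of the augmentation ideal\<close>

lemma neg_one_plus_neg_one: "- 1 - 1 = (1::'k)" "1 + 1 = (-1 :: 'k)" "(2::'k) = -1"
  using triple[of 1] by (simp_all add: algebra_simps eq_neg_iff_add_eq_0)

text \<open>An affine relation between points is annihilated by 1 and the coordinate functions. Rows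
  are checked by cases; for columns, swapping coordinates carries relations to relations.\<close>

lemma affine_relation_in_aug_ideal_sq: "affine_relation p \<in> (aug_ideal_sq :: (point \<Rightarrow> 'k) set)"
proof -
  have "row_sum (affine_relation p :: point \<Rightarrow> 'k) i = row_sum (affine_relation p) 0" for p i
    using in_3_cases[of i] in_3_cases[of "fst p"] in_3_cases[of "snd p"]
    by (cases p) (auto simp: row_sum_def sum_3 affine_relation_def lift_3_def point_vector_Pair
        zero_prod_def neg_one_plus_neg_one)
  moreover have "affine_relation p \<circ> prod.swap = (affine_relation (prod.swap p) :: point \<Rightarrow> 'k)" for p
  proof
    fix z
    have swap: "point_vector q (prod.swap z) = (point_vector (prod.swap q) z :: 'k)" for q
      by (cases q; cases z) (simp add: point_vector_def conj_commute)
    have "prod.swap 0 = (0 :: point)" by (simp add: zero_prod_def)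
    then show "(affine_relation p \<circ> prod.swap) z = (affine_relation (prod.swap p) z :: 'k)"
      by (simp add: affine_relation_def swap)
  qed
  ultimately show ?thesis by (simp add: aug_ideal_sq_def)
qed

text \<open>Row 2 and column 2 miss the frame, so all row and column sums are 0. Row 1 and column 1
  each contain one frame point, and the origin follows.\<close>

lemma aug_ideal_sq_eq_0:
  fixes f :: "point \<Rightarrow> 'k"
  assumes "f \<in> aug_ideal_sq" "\<And>p. p \<in> off_frame \<Longrightarrow> f p = 0"
  shows "f = (\<lambda>z. 0)"
proof -
  have z: "f (i, j) = 0" if "i = 2 \<or> j = 2 \<or> i = 1 \<and> j = 1" for i j
    using that by (intro assms(2)) (auto simp: off_frame_def)
  have "f (1, 0) = 0" "f (0, 1) = 0" "f (0, 0) = 0"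
    using aug_ideal_sq_row_sums[OF assms(1), of 1] aug_ideal_sq_row_sums[OF assms(1), of 2]
    by (simp_all add: row_sum_def sum_3 z)
  then have "f (i, j) = 0" for i j
    using z in_3_cases[of i] in_3_cases[of j] by auto
  then show ?thesis by (auto simp: fun_eq_iff)
qed

lemma affine_relation_off_frame:
  "p \<in> off_frame \<Longrightarrow> q \<in> off_frame \<Longrightarrow> affine_relation p q = (if p = q then 1 else 0 :: 'k)"
  by (auto simp: off_frame_def affine_relation_def point_vector_def zero_prod_def)

lemma dim_aug_ideal_sq: "subspace_dim class_ring matsuo_algebra (aug_ideal_sq :: (point \<Rightarrow> 'k) set) = 6"
proof -
  have "subspace_dim class_ring matsuo_algebra (aug_ideal_sq :: (point \<Rightarrow> 'k) set) = card off_frame"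
    by (rule subspace_dim_matsuo[OF submodule_aug_ideal_sq, where w = affine_relation])
       (auto simp: affine_relation_in_aug_ideal_sq affine_relation_off_frame intro!: aug_ideal_sq_eq_0)
  also have "\<dots> = card (UNIV :: point set) - card {(0::3, 0::3), (1, 0), (0, 1)}"
    unfolding off_frame_def by (rule card_Diff_subset) auto
  also have "\<dots> = 6" by simp
  finally show ?thesis .
qed

lemma aug_ideal_sq_expansion:
  fixes f :: "point \<Rightarrow> 'k"
  assumes "f \<in> aug_ideal_sq"
  shows "f z = (\<Sum>p\<in>off_frame. f p * affine_relation p z)"
proof -
  interpret submodule class_ring "aug_ideal_sq :: (point \<Rightarrow> 'k) set" matsuo_algebra
    by (rule submodule_aug_ideal_sq)
  let ?g = "\<lambda>z. \<Sum>p\<in>off_frame. f p * affine_relation p z"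
  have "?g \<in> aug_ideal_sq"
  proof -
    have "(\<lambda>z. \<Sum>p\<in>A. f p * affine_relation p z) \<in> aug_ideal_sq" if "finite A" for A
      using that
    proof induction
      case (insert x F)
      then show ?case
        using m_closed[OF smult_closed[of "f x", OF _ affine_relation_in_aug_ideal_sq] insert.IH, of x] by simp
    qed (use zero_closed in simp)
    then show ?thesis by simp
  qed
  then have "(\<lambda>z. f z + - 1 * ?g z) \<in> aug_ideal_sq"
    using m_closed[OF assms smult_closed[of "- 1" ?g]] by simp
  then have "(\<lambda>z. f z + - 1 * ?g z) = (\<lambda>z. 0)"
  proof (rule aug_ideal_sq_eq_0)
    fix q assume q: "q \<in> off_frame"
    have "?g q = (\<Sum>p\<in>off_frame. if p = q then f p else 0)"
      by (intro sum.cong) (auto simp: affine_relation_off_frame q)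
    then show "f q + - 1 * ?g q = 0" using q by simp
  qed
  from fun_cong[OF this, of z] show ?thesis by simp
qed

section \<open>Generating the ideals by products\<close>

lemma mult_point_vector_diff:
  "mult matsuo_algebra (\<lambda>z. point_vector (- u) z - point_vector 0 z) (\<lambda>z. point_vector 0 z - point_vector (- v) z)
    = (\<lambda>z. point_vector (u + v) z - point_vector u z - point_vector v z + point_vector 0 z :: 'k)"
proof
  fix z
  have "point_vector 0 (- z - - u) = (point_vector u z :: 'k)"
    "point_vector (- v) (- z - - u) = (point_vector (u + v) z :: 'k)"
    "point_vector 0 (- z - 0) = (point_vector 0 z :: 'k)"
    "point_vector (- v) (- z - 0) = (point_vector v z :: 'k)"
    by (rule point_vector_eqI; auto simp: algebra_simps add_eq_0_iff)+
  then show "mult matsuo_algebra (\<lambda>z. point_vector (- u) z - point_vector 0 z) (\<lambda>z. point_vector 0 z - point_vector (- v) z) z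
    = (point_vector (u + v) z - point_vector u z - point_vector v z + point_vector 0 z :: 'k)"
    by (simp add: matsuo_mult sum_subtractf sum_point_vector_1 left_diff_distrib sum_point_vector_left
         del: diff_minus_eq_add diff_0_right)
qed

lemma second_difference_in_ideal_square:
  "(\<lambda>z. point_vector (u + v) z - point_vector u z - point_vector v z + point_vector 0 z :: 'k)
    \<in> ideal_square class_ring matsuo_algebra aug_ideal"
  unfolding mult_point_vector_diff[symmetric]
  by (rule mult_in_ideal_square) (simp_all add: aug_ideal_def sum_subtractf sum_point_vector_1)

text \<open>Second differences are products in the group algebra of a point minus the origin with
  another such difference. The relation of (i, j) is the second difference for (i, 0) and (0, j)
  plus two axis relations, each of which is 0 or a second difference since 2 = 1 + 1.\<close>

lemma affine_relation_in_ideal_square: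
  "affine_relation p \<in> ideal_square class_ring matsuo_algebra (aug_ideal :: (point \<Rightarrow> 'k) set)" (is "_ \<in> ?N")
proof -
  interpret submodule class_ring ?N matsuo_algebra by (rule ideal_square_submodule)
  have add: "f \<in> ?N \<Longrightarrow> g \<in> ?N \<Longrightarrow> (\<lambda>z. f z + g z) \<in> ?N" for f g
    using m_closed[of f g] by simp
  have 1: "affine_relation (i, 0) \<in> ?N" for i
  proof -
    have "affine_relation (0, 0) = (\<lambda>z. 0 :: 'k)" "affine_relation (1, 0) = (\<lambda>z. 0 :: 'k)"
      "affine_relation (2, 0) = (\<lambda>z. point_vector ((1,0) + (1,0)) z - point_vector (1,0) z - point_vector (1,0) z + point_vector 0 z :: 'k)"
      using neg_one_plus_neg_one
      by (auto simp: fun_eq_iff affine_relation_def lift_3_def zero_prod_def point_vector_Pair)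
    moreover from this have "affine_relation (2, 0) \<in> ?N"
      using second_difference_in_ideal_square by (simp only:)
    ultimately show ?thesis using in_3_cases[of i] zero_closed by auto
  qed
  have 2: "affine_relation (0, j) \<in> ?N" for j
  proof -
    have "affine_relation (0, 0) = (\<lambda>z. 0 :: 'k)" "affine_relation (0, 1) = (\<lambda>z. 0 :: 'k)"
      "affine_relation (0, 2) = (\<lambda>z. point_vector ((0,1) + (0,1)) z - point_vector (0,1) z - point_vector (0,1) z + point_vector 0 z :: 'k)"
      using neg_one_plus_neg_one
      by (auto simp: fun_eq_iff affine_relation_def lift_3_def zero_prod_def point_vector_Pair)
    moreover from this have "affine_relation (0, 2) \<in> ?N"
      using second_difference_in_ideal_square by (simp only:)
    ultimately show ?thesis using in_3_cases[of j] zero_closed by auto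
  qed
  obtain i j where p: "p = (i, j)" by fastforce
  have "affine_relation p = (\<lambda>z. (point_vector ((i,0) + (0,j)) z - point_vector (i,0) z - point_vector (0,j) z + point_vector 0 z)
      + (affine_relation (i, 0) z + affine_relation (0, j) z) :: 'k)"
    by (simp add: p fun_eq_iff affine_relation_def lift_3_def[of 0] algebra_simps)
  then show ?thesis using add[OF second_difference_in_ideal_square add[OF 1 2]] by (simp only:)
qed

lemma ideal_square_aug_ideal:
  "ideal_square class_ring matsuo_algebra aug_ideal = (aug_ideal_sq :: (point \<Rightarrow> 'k) set)"
proof
  show "ideal_square class_ring matsuo_algebra aug_ideal \<subseteq> (aug_ideal_sq :: (point \<Rightarrow> 'k) set)"
    by (rule ideal_square_subset[OF submodule_aug_ideal_sq matsuo_mult_aug])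
  let ?N = "ideal_square class_ring matsuo_algebra (aug_ideal :: (point \<Rightarrow> 'k) set)"
  interpret submodule class_ring ?N matsuo_algebra by (rule ideal_square_submodule)
  show "aug_ideal_sq \<subseteq> ?N"
  proof
    fix f :: "point \<Rightarrow> 'k" assume f: "f \<in> aug_ideal_sq"
    have "(\<lambda>z. \<Sum>p\<in>A. f p * affine_relation p z) \<in> ?N" if "finite A" for A
      using that
    proof induction
      case (insert x F)
      then show ?case
        using m_closed[OF smult_closed[of "f x", OF _ affine_relation_in_ideal_square] insert.IH, of x] by simp
    qed (use zero_closed in simp)
    from this[of off_frame] show "f \<in> ?N"
      by (simp flip: aug_ideal_sq_expansion[OF f])
  qed
qed

lemma ideal_square_aug_ideal_sq:
  "ideal_square class_ring matsuo_algebra aug_ideal_sq = (const_ideal :: (point \<Rightarrow> 'k) set)"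
proof
  show "ideal_square class_ring matsuo_algebra aug_ideal_sq \<subseteq> (const_ideal :: (point \<Rightarrow> 'k) set)"
    by (rule ideal_square_subset[OF submodule_const_ideal]) (auto simp: matsuo_mult_aug_sq const_ideal_eq)
  let ?N = "ideal_square class_ring matsuo_algebra (aug_ideal_sq :: (point \<Rightarrow> 'k) set)"
  interpret submodule class_ring ?N matsuo_algebra by (rule ideal_square_submodule)
  \<comment> \<open>These relations are s^2 and t^2, for s and t the unit points minus the origin;
    their supports meet only at the origin.\<close>
  have "(\<Sum>x\<in>UNIV. affine_relation (2, 0) x * affine_relation (0, 2) x) = (1 :: 'k)"
    by (simp add: sum_point sum_3 affine_relation_def lift_3_def zero_prod_def point_vector_Pair neg_one_plus_neg_one)
  then have "mult matsuo_algebra (affine_relation (2, 0)) (affine_relation (0, 2)) = (\<lambda>z. - 1 :: 'k)"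
    by (simp add: matsuo_mult_aug_sq affine_relation_in_aug_ideal_sq)
  then have "(\<lambda>z. - 1) \<in> ?N"
    using mult_in_ideal_square[OF affine_relation_in_aug_ideal_sq affine_relation_in_aug_ideal_sq] by metis
  then have "(\<lambda>z. c) \<in> ?N" for c
    using smult_closed[of "- c" "\<lambda>z. - 1"] by simp
  then show "const_ideal \<subseteq> ?N" by (auto simp: const_ideal_eq)
qed

lemma ideal_square_const_ideal:
  "ideal_square class_ring matsuo_algebra const_ideal = {\<lambda>z. 0 :: 'k}"
proof
  show "ideal_square class_ring matsuo_algebra const_ideal \<subseteq> {\<lambda>z. 0 :: 'k}"
    by (rule ideal_square_subset[OF submodule_matsuoI]) (auto simp: const_ideal_eq matsuo_mult_const)
  interpret submodule class_ring "ideal_square class_ring matsuo_algebra (const_ideal :: (point \<Rightarrow> 'k) set)" matsuo_algebra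
    by (rule ideal_square_submodule)
  show "{\<lambda>z. 0 :: 'k} \<subseteq> ideal_square class_ring matsuo_algebra const_ideal"
    using zero_closed by simp
qed

section \<open>The radical, absolute zero divisors and the strict chain\<close>

lemma algebra_ideal_matsuoI:
  fixes I :: "(point \<Rightarrow> 'k) set"
  assumes "LinearCombinations.submodule class_ring I matsuo_algebra"
    and "\<And>f g. f \<in> I \<Longrightarrow> mult matsuo_algebra f g \<in> I"
  shows "algebra_ideal class_ring matsuo_algebra I"
  unfolding algebra_ideal_def
  using assms matsuo_comm by (metis subspace.intro vectorspace_matsuo)

lemma algebra_ideals:
  "algebra_ideal class_ring matsuo_algebra (aug_ideal :: (point \<Rightarrow> 'k) set)"
  "algebra_ideal class_ring matsuo_algebra (aug_ideal_sq :: (point \<Rightarrow> 'k) set)"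
  "algebra_ideal class_ring matsuo_algebra (const_ideal :: (point \<Rightarrow> 'k) set)"
proof -
  show "algebra_ideal class_ring matsuo_algebra (aug_ideal :: (point \<Rightarrow> 'k) set)"
    by (rule algebra_ideal_matsuoI[OF submodule_aug_ideal]) (simp add: aug_ideal_def sum_matsuo_mult)
  show "algebra_ideal class_ring matsuo_algebra (aug_ideal_sq :: (point \<Rightarrow> 'k) set)"
    by (rule algebra_ideal_matsuoI[OF submodule_aug_ideal_sq matsuo_mult_aug_sq_left])
  show "algebra_ideal class_ring matsuo_algebra (const_ideal :: (point \<Rightarrow> 'k) set)"
    by (rule algebra_ideal_matsuoI[OF submodule_const_ideal]) (auto simp: const_ideal_eq matsuo_mult_const)
qed

lemma is_radical_aug_ideal: "is_radical class_ring matsuo_algebra (aug_ideal :: (point \<Rightarrow> 'k) set)"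
  unfolding is_radical_def
proof (intro conjI allI impI)
  \<comment> \<open>Three squarings lead from R through T and Z to 0.\<close>
  have "(ideal_square class_ring matsuo_algebra ^^ 3) aug_ideal = {\<lambda>z. 0 :: 'k}"
    by (simp add: numeral_3_eq_3 ideal_square_aug_ideal ideal_square_aug_ideal_sq ideal_square_const_ideal)
  then show "solvable_ideal class_ring matsuo_algebra (aug_ideal :: (point \<Rightarrow> 'k) set)"
    unfolding solvable_ideal_def using algebra_ideals(1) by auto
  fix I :: "(point \<Rightarrow> 'k) set" assume I: "solvable_ideal class_ring matsuo_algebra I"
  then obtain k where k: "(ideal_square class_ring matsuo_algebra ^^ k) I = {\<lambda>z. 0}"
    by (auto simp: solvable_ideal_def)
  show "I \<subseteq> aug_ideal"
  proof (rule ccontr)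
    assume "\<not> I \<subseteq> aug_ideal"
    then have "\<exists>f\<in>I. sum f UNIV \<noteq> 0" by (auto simp: aug_ideal_def)
    \<comment> \<open>The square of an element of nonzero augmentation again has nonzero
      augmentation, so no iterated square of \<open>I\<close> is 0.\<close>
    then have "\<exists>f\<in>(ideal_square class_ring matsuo_algebra ^^ n) I. sum f UNIV \<noteq> 0" for n
    proof (induction n)
      case (Suc n)
      then obtain f where "f \<in> (ideal_square class_ring matsuo_algebra ^^ n) I" "sum f UNIV \<noteq> 0" by blast
      then show ?case
        by (intro bexI[of _ "mult matsuo_algebra f f"]) (simp_all add: sum_matsuo_mult mult_in_ideal_square)
    qed simp
    from this[of k] show False by (simp add: k)
  qed
qed

text \<open>An identity would have to fix the constant 1, which annihilates the algebra.\<close>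

lemma not_unital_matsuo: "\<not> unital (matsuo_algebra :: ('k, point \<Rightarrow> 'k) module)"
proof
  assume "unital (matsuo_algebra :: ('k, point \<Rightarrow> 'k) module)"
  then obtain e :: "point \<Rightarrow> 'k" where e: "mult matsuo_algebra x e = x" for x
    by (auto simp: unital_def)
  have "mult matsuo_algebra (\<lambda>z. 1) e = (\<lambda>z. 0 :: 'k)" by (rule matsuo_mult_const)
  with e[of "\<lambda>z. 1"] show False by (metis zero_neq_one)
qed

text \<open>The first term of the U-operator vanishes by \<open>matsuo_mult_aug_sq_twice\<close>,
  the second because the square of \<open>a\<close> is a constant.\<close>

lemma absolute_zero_divisor_aug_ideal_sq:
  fixes a :: "point \<Rightarrow> 'k"
  assumes a: "a \<in> aug_ideal_sq"
  shows "absolute_zero_divisor class_ring matsuo_algebra a"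
proof -
  interpret vectorspace class_ring "matsuo_algebra :: ('k, point \<Rightarrow> 'k) module" by (rule vectorspace_matsuo)
  have "\<ominus>\<^bsub>matsuo_algebra\<^esub> (\<lambda>z. 0) = (\<lambda>z. 0 :: 'k)" using r_neg[of "\<lambda>z. 0"] by simp
  moreover have "mult matsuo_algebra (mult matsuo_algebra a a) b = (\<lambda>z. 0)" for b
    by (simp add: matsuo_mult_aug_sq[OF a a] matsuo_mult_const)
  ultimately show ?thesis
    by (simp add: absolute_zero_divisor_def U_operator_def matsuo_mult_aug_sq_twice[OF a] a_minus_def)
qed

lemma trivial_const_ideal:
  fixes z :: "point \<Rightarrow> 'k"
  assumes "z \<in> const_ideal"
  shows "trivial_element class_ring matsuo_algebra z"
proof -
  show ?thesis using assms const_ideal_subset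
    by (auto simp: trivial_element_def absolute_zero_divisor_aug_ideal_sq const_ideal_eq matsuo_mult_const)
qed

lemma strict_chain:
  "{\<lambda>z. 0} \<subset> (const_ideal :: (point \<Rightarrow> 'k) set)"
  "const_ideal \<subset> (aug_ideal_sq :: (point \<Rightarrow> 'k) set)"
  "aug_ideal_sq \<subset> (aug_ideal :: (point \<Rightarrow> 'k) set)"
  "aug_ideal \<subset> (UNIV :: (point \<Rightarrow> 'k) set)"
proof -
  have "(\<lambda>z. 0 :: 'k) \<in> const_ideal" "(\<lambda>z. 1 :: 'k) \<in> const_ideal" by (simp_all add: const_ideal_def)
  moreover have "(\<lambda>z. 1 :: 'k) \<noteq> (\<lambda>z. 0)" by (simp add: fun_eq_iff)
  ultimately show "{\<lambda>z. 0} \<subset> (const_ideal :: (point \<Rightarrow> 'k) set)" by blast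
  \<comment> \<open>The dimensions 1, 6 and 8 separate the ideals.\<close>
  have "const_ideal \<noteq> (aug_ideal_sq :: (point \<Rightarrow> 'k) set)" "aug_ideal_sq \<noteq> (aug_ideal :: (point \<Rightarrow> 'k) set)"
    using dim_aug_ideal[where 'k = 'k] dim_aug_ideal_sq dim_const_ideal[where 'k = 'k] by auto
  then show "const_ideal \<subset> (aug_ideal_sq :: (point \<Rightarrow> 'k) set)"
    "aug_ideal_sq \<subset> (aug_ideal :: (point \<Rightarrow> 'k) set)"
    using const_ideal_subset aug_ideal_sq_subset by auto
  have "(point_vector 0 :: point \<Rightarrow> 'k) \<notin> aug_ideal" by (simp add: aug_ideal_def sum_point_vector_1)
  then show "aug_ideal \<subset> (UNIV :: (point \<Rightarrow> 'k) set)" by auto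
qed

section \<open>The residue algebra as the base field\<close>

lemma residue_mult: "mult residue_algebra (aug_fibre c) (aug_fibre d) = aug_fibre (c * d :: 'k)"
proof -
  have "mult residue_algebra (aug_fibre c) (aug_fibre d) = (\<Union>f\<in>aug_fibre c. \<Union>g\<in>aug_fibre d. aug_fibre (c * d :: 'k))"
    by (simp add: quotient_algebra_def ring.extend_def FactRing_def rcoset_mult_def aug_coset
        sum_matsuo_mult aug_fibre_def)
  then show ?thesis using ex_sum[of c] ex_sum[of d] by (auto simp: aug_fibre_def[of c] aug_fibre_def[of d])
qed

lemmas residue_simps = residue_carrier residue_zero residue_add residue_smult residue_mult

lemma jordan_algebra_residue: "jordan_algebra class_ring (residue_algebra :: ('k, (point \<Rightarrow> 'k) set) module)"
proof -
  let ?Q = "residue_algebra :: ('k, (point \<Rightarrow> 'k) set) module"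
  have "abelian_group ?Q"
  proof (rule abelian_groupI)
    fix X assume "X \<in> carrier ?Q"
    then obtain c where "X = aug_fibre c" by (auto simp: residue_simps)
    then show "\<exists>Y\<in>carrier ?Q. Y \<oplus>\<^bsub>?Q\<^esub> X = \<zero>\<^bsub>?Q\<^esub>"
      by (intro bexI[of _ "aug_fibre (- c)"]) (simp_all add: residue_simps)
  qed (auto simp: residue_simps algebra_simps)
  then have "module class_ring ?Q"
    by (intro Module.moduleI class_cring.is_cring) (auto simp: residue_simps algebra_simps)
  then have "vectorspace class_ring ?Q"
    by (intro vectorspace.intro class_field)
  then show ?thesis
    by (intro jordan_algebra.intro nonassoc_algebra.intro jordan_algebra_axioms.intro)
       (auto simp: residue_simps algebra_simps)
qed

lemma unital_residue: "unital (residue_algebra :: ('k, (point \<Rightarrow> 'k) set) module)"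
  unfolding unital_def by (rule bexI[of _ "aug_fibre 1"]) (auto simp: residue_simps)

lemma residue_iso_field:
  "algebra_isomorphic class_ring (residue_algebra :: ('k, (point \<Rightarrow> 'k) set) module) (field_algebra class_ring)"
proof -
  define \<phi> :: "(point \<Rightarrow> 'k) set \<Rightarrow> 'k" where "\<phi> = the_inv aug_fibre"
  have \<phi>: "\<phi> (aug_fibre c) = c" for c
    unfolding \<phi>_def by (rule the_inv_f_f[OF inj_aug_fibre])
  have "bij_betw \<phi> (range aug_fibre) UNIV"
    by (rule bij_betw_byWitness[of _ aug_fibre]) (auto simp: \<phi>)
  then have "\<phi> \<in> algebra_iso class_ring residue_algebra (field_algebra class_ring)"
    by (auto simp: algebra_iso_def LinearCombinations.module_hom_def residue_simps \<phi> field_algebra_def ring.extend_def module.fields_def)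
  then show ?thesis by (auto simp: algebra_isomorphic_def)
qed

end

theorem theorem4p8:
  fixes F :: "'k::field ring"
  defines "F \<equiv> class_ring"
  assumes "CHAR('k) = 3"
  shows "\<exists>(J :: ('k, point \<Rightarrow> 'k) module) R.
    algebra_isomorphic F matsuo_algebra J \<and>
    jordan_algebra F J \<and> \<not> unital J \<and>
    vectorspace.fin_dim F J \<and> vectorspace.dim F J = 9 \<and>
    is_radical F J R \<and> subspace_dim F J R = 8 \<and>
    (\<exists>Z T.
      algebra_ideal F J Z \<and> algebra_ideal F J T \<and> algebra_ideal F J R \<and>
      {\<zero>\<^bsub>J\<^esub>} \<subset> Z \<and> Z \<subset> T \<and> T \<subset> R \<and> R \<subset> carrier J \<and>
      subspace_dim F J Z = 1 \<and> subspace_dim F J T = 6 \<and>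
      Z = ideal_square F J T \<and> T = ideal_square F J R \<and>
      (\<forall>z\<in>Z. trivial_element F J z) \<and>
      (\<forall>t\<in>T. absolute_zero_divisor F J t) \<and>
      jordan_algebra F (quotient_algebra J R) \<and> unital (quotient_algebra J R) \<and>
      algebra_isomorphic F (quotient_algebra J R) (field_algebra F))"
proof -
  note char3 = \<open>CHAR('k) = 3\<close>
  let ?J = "matsuo_algebra :: ('k, point \<Rightarrow> 'k) module"
  \<comment> \<open>The Matsuo algebra itself serves as J.\<close>
  have "id \<in> algebra_iso class_ring ?J ?J"
    by (simp add: algebra_iso_def LinearCombinations.module_hom_def)
  then have iso: "algebra_isomorphic class_ring ?J ?J"
    unfolding algebra_isomorphic_def by blast
  have bounds: "{\<zero>\<^bsub>?J\<^esub>} \<subset> const_ideal" "aug_ideal \<subset> carrier ?J"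
    using strict_chain[OF char3] by simp_all
  show ?thesis
    unfolding F_def
    by (rule exI[of _ ?J], rule exI[of _ aug_ideal], intro conjI,
      (rule iso jordan_algebra_matsuo[OF char3] not_unital_matsuo[OF char3] dim_matsuo
        is_radical_aug_ideal[OF char3] dim_aug_ideal)+,
      rule exI[of _ const_ideal], rule exI[of _ aug_ideal_sq], intro conjI ballI,
      (rule algebra_ideals[OF char3] bounds strict_chain[OF char3] dim_const_ideal dim_aug_ideal_sq[OF char3]
        ideal_square_aug_ideal_sq[OF char3, symmetric] ideal_square_aug_ideal[OF char3, symmetric]
        jordan_algebra_residue[OF char3] unital_residue[OF char3] residue_iso_field[OF char3]
      | erule trivial_const_ideal[OF char3] absolute_zero_divisor_aug_ideal_sq[OF char3])+)
qed

end
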